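(* Let $t$ be an indeterminate. As formal series in $z$ with coefficients in the $\mathbb{Q}(t)$-linear operators on $\Gamma_{\mathbb{Q}(t)}$, the modified operator is a conjugate of the classical neutral operator: $$\mathcal{Y}(z;t)=\rho_t\,\Phi(z)\,\rho_t^{-1}.$$ Consequently, for every strict partition $\lambda$, $$\mathcal{Q}_\lambda(X;t)=\rho_t Q_\lambda(X)=Q_\lambda[X-tX].$$
   Context: $\Gamma=\mathbb{Q}[p_1,p_3,p_5,\ldots]$ is the polynomial ring in the odd power sums, graded by $\deg p_n=n$ (elements may be viewed as symmetric functions in an alphabet $X$), and $\Gamma_{\mathbb{Q}(t)}=\Gamma\otimes_{\mathbb{Q}}\mathbb{Q}(t)$. The element $\mathbf{1}\in\Gamma$ is the unit. For odd $n\ge1$, let $a_{-n}$ be multiplication by $p_n$ and $a_n=\frac n2\frac{\partial}{\partial p_n}$. Classical neutral operator: $$\Phi(z)=\exp\Big(\sum_{n\ge1,\ n\text{ odd}}\tfrac2n a_{-n}z^n\Big)\exp\Big(-\sum_{n\ge1,\ n\text{ odd}}\tfrac2n a_nz^{-n}\Big).$$ Modified operator: $$\mathcal{Y}(z;t)=\exp\Big(\sum_{n\ge1,\ n\text{ odd}}\tfrac{2(1-t^n)}n a_{-n}z^n\Big)\exp\Big(-\sum_{n\ge1,\ n\text{ odd}}\tfrac2{n(1-t^n)} a_nz^{-n}\Big)=\sum_{m\in\mathbb{Z}}\mathcal{Y}_m(t)z^{-m}.$$ $\rho_t:\Gamma_{\mathbb{Q}(t)}\to\Gamma_{\mathbb{Q}(t)}$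 is the graded $\mathbb{Q}(t)$-algebra automorphism with $\rho_t(p_n)=(1-t^n)p_n$ for $n$ odd. In plethystic notation, $f[X-tX]$ is the image of $f\in\Gamma$ under $p_n\mapsto p_n[X-tX]=(1-t^n)p_n$. A strict partition is a finite sequence $\lambda=(\lambda_1>\cdots>\lambda_\ell>0)$ of integers. For such $\lambda$, $$\mathcal{Q}_\lambda(X;t)=\mathcal{Y}_{-\lambda_1}(t)\cdots\mathcal{Y}_{-\lambda_\ell}(t)\mathbf{1}.$$ Schur $Q$-functions $Q_\lambda\in\Gamma$: the one-row functions $q_r=Q_{(r)}$ are given by $\sum_{r\ge0}q_rz^r=\exp\big(2\sum_{n\text{ odd}}\frac{p_n}{n}z^n\big)$ (so $q_0=1$, and $q_r=0$ for $r<0$); for $r\ge s\ge0$, $Q_{(r,s)}=q_rq_s+2\sum_{k=1}^s(-1)^kq_{r+k}q_{s-k}$ (with $Q_{(r,0)}=q_r$ and $Q_{(r,r)}=0$); and in general $Q_\lambda=\operatorname{Pf}\big(Q_{(\lambda_i,\lambda_j)}\big)$, the Pfaffian of the skew-symmetric matrix whose $(i,j)$ entry for $i<j$ is $Q_{(\lambda_i,\lambda_j)}$, where a zero part is appended to $\lambda$ if its length is odd (and $Q_\emptyset=1$). *)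

theory Defs
  imports
    "HOL-Library.Poly_Mapping"
    "HOL-Computational_Algebra.Formal_Power_Series"
    "HOL-Computational_Algebra.Polynomial_Factorial"
    "HOL-Combinatorics.Permutations"
begin

section \<open>The ring of odd power sums\<close>

text \<open>
  Polynomials over \<open>'k\<close> in $p_1, p_3, p_5, \dots$ are finitely supported functions from
  exponent vectors to coefficients. The entry of an exponent vector at \<open>k\<close> is the exponent of
  $p_{2k+1}$, so there is no variable $p_n$ for even \<open>n\<close>.
\<close>

type_synonym 'k odd_poly = "(nat \<Rightarrow>\<^sub>0 nat) \<Rightarrow>\<^sub>0 'k"

type_synonym ratfun = "rat poly fract"

type_synonym gamma = "rat odd_poly"

type_synonym gamma_t = "ratfun odd_poly"

definition t_var :: ratfun where
  "t_var = to_fract [:0, 1:]"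

definition rat_const :: "rat \<Rightarrow> ratfun" where
  "rat_const c = to_fract [:c:]"

definition const_poly :: "'k::comm_ring_1 \<Rightarrow> 'k odd_poly" where
  "const_poly c = Poly_Mapping.single 0 c"

text \<open>Only meaningful for odd \<open>n\<close>.\<close>

definition psum :: "nat \<Rightarrow> 'k::comm_ring_1 odd_poly" where
  "psum n = Poly_Mapping.single (Poly_Mapping.single (n div 2) 1) 1"

text \<open>The embedding $f \mapsto f \otimes 1$ of $\Gamma$ into $\Gamma \otimes \mathbb{Q}(t)$.\<close>

definition extend_scalars :: "gamma \<Rightarrow> gamma_t" where
  "extend_scalars f = Poly_Mapping.map rat_const f"

text \<open>
  The homomorphism that acts on coefficients by \<open>h\<close> and sends $p_n$ to \<open>g n\<close> for odd \<open>n\<close>.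
\<close>

definition eval_poly :: "('k::comm_ring_1 \<Rightarrow> 'r::comm_ring_1) \<Rightarrow> (nat \<Rightarrow> 'r) \<Rightarrow> 'k odd_poly \<Rightarrow> 'r" where
  "eval_poly h g f = (\<Sum>m\<in>Poly_Mapping.keys f. h (Poly_Mapping.lookup f m) *
     (\<Prod>k\<in>Poly_Mapping.keys m. g (2 * k + 1) ^ Poly_Mapping.lookup m k))"

definition rho_t :: "gamma_t \<Rightarrow> gamma_t" where
  "rho_t = eval_poly const_poly (\<lambda>n. const_poly (1 - t_var ^ n) * psum n)"

text \<open>$f \mapsto f[X - tX]$.\<close>

definition pleth_X_minus_tX :: "gamma \<Rightarrow> gamma_t" where
  "pleth_X_minus_tX = eval_poly (\<lambda>c. const_poly (rat_const c)) (\<lambda>n. const_poly (1 - t_var ^ n) * psum n)"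

definition partial :: "nat \<Rightarrow> 'k::comm_ring_1 odd_poly \<Rightarrow> 'k odd_poly" where
  "partial n f = (\<Sum>m\<in>Poly_Mapping.keys f.
     Poly_Mapping.single (m - Poly_Mapping.single (n div 2) 1)
       (of_nat (Poly_Mapping.lookup m (n div 2)) * Poly_Mapping.lookup f m))"


section \<open>The algebra of linear operators\<close>

definition is_linear :: "(gamma_t \<Rightarrow> gamma_t) \<Rightarrow> bool" where
  "is_linear A \<longleftrightarrow> (\<forall>f g. A (f + g) = A f + A g) \<and> (\<forall>c f. A (const_poly c * f) = const_poly c * A f)"

typedef lin_op = "{A. is_linear A}"
  morphisms app Lin_op
  by (rule exI[of _ id]) (simp add: is_linear_def)

setup_lifting type_definition_lin_op

text \<open>The product of operators is composition.\<close>

instantiation lin_op :: ring_1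
begin

lift_definition zero_lin_op :: lin_op is "\<lambda>_. 0"
  by (simp add: is_linear_def)

lift_definition one_lin_op :: lin_op is "\<lambda>f. f"
  by (simp add: is_linear_def)

lift_definition plus_lin_op :: "lin_op \<Rightarrow> lin_op \<Rightarrow> lin_op" is "\<lambda>A B f. A f + B f"
  by (simp add: is_linear_def algebra_simps)

lift_definition uminus_lin_op :: "lin_op \<Rightarrow> lin_op" is "\<lambda>A f. - A f"
  by (simp add: is_linear_def)

lift_definition minus_lin_op :: "lin_op \<Rightarrow> lin_op \<Rightarrow> lin_op" is "\<lambda>A B f. A f - B f"
  by (simp add: is_linear_def algebra_simps)

lift_definition times_lin_op :: "lin_op \<Rightarrow> lin_op \<Rightarrow> lin_op" is "\<lambda>A B f. A (B f)"
  by (simp add: is_linear_def)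

instance
proof
  show "(0::lin_op) \<noteq> 1"
    by transfer (metis zero_neq_one)
qed (transfer; auto simp: is_linear_def algebra_simps)+

end

definition scalar_op :: "ratfun \<Rightarrow> lin_op" where
  "scalar_op c = Lin_op (\<lambda>f. const_poly c * f)"

lemma app_scalar_op [simp]: "app (scalar_op c) f = const_poly c * f"
  by (simp add: scalar_op_def Lin_op_inverse is_linear_def algebra_simps)

lemma partial_superset:
  assumes "finite S" "Poly_Mapping.keys f \<subseteq> S"
  shows "partial n f = (\<Sum>m\<in>S. Poly_Mapping.single (m - Poly_Mapping.single (n div 2) 1)
    (of_nat (Poly_Mapping.lookup m (n div 2)) * Poly_Mapping.lookup f m))"
  unfolding partial_def using assms
  by (intro sum.mono_neutral_left) (auto simp: in_keys_iff)

lemma lookup_const_poly_mult: "Poly_Mapping.lookup (const_poly c * f) m = c * Poly_Mapping.lookup f m"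
  unfolding const_poly_def mult_map_scale_conv_mult[symmetric] by (simp add: map.rep_eq when_def)

lemma const_poly_mult_single:
  "const_poly c * Poly_Mapping.single m d = Poly_Mapping.single m (c * d)"
  by (simp add: const_poly_def mult_single)

lemma keys_const_poly_mult: "Poly_Mapping.keys (const_poly c * f) \<subseteq> Poly_Mapping.keys f"
  by (auto simp: in_keys_iff lookup_const_poly_mult)

lemma is_linear_partial: "is_linear (partial n)"
  unfolding is_linear_def
proof (intro conjI allI)
  fix f g :: gamma_t and c :: ratfun
  let ?S = "Poly_Mapping.keys f \<union> Poly_Mapping.keys g"
  show "partial n (f + g) = partial n f + partial n g"
    using Poly_Mapping.keys_add[of f g]
    by (simp add: partial_superset[of ?S] lookup_add single_add distrib_left sum.distrib)
  show "partial n (const_poly c * f) = const_poly c * partial n f"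
    using keys_const_poly_mult[of c f]
    by (simp add: partial_superset[of "Poly_Mapping.keys f"] sum_distrib_left
        lookup_const_poly_mult const_poly_mult_single mult.left_commute)
qed

text \<open>For odd \<open>n \<ge> 1\<close>, \<open>creation n\<close> is $a_{-n}$ and \<open>annihilation n\<close> is $a_n$.\<close>

definition creation :: "nat \<Rightarrow> lin_op" where
  "creation n = Lin_op (\<lambda>f. psum n * f)"

definition partial_op :: "nat \<Rightarrow> lin_op" where
  "partial_op n = Lin_op (partial n)"

definition annihilation :: "nat \<Rightarrow> lin_op" where
  "annihilation n = scalar_op (of_nat n / 2) * partial_op n"

lemma app_creation [simp]: "app (creation n) f = psum n * f"
  by (simp add: creation_def Lin_op_inverse is_linear_def algebra_simps)

lemma app_partial_op [simp]: "app (partial_op n) f = partial n f"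
  by (simp add: partial_op_def Lin_op_inverse is_linear_partial)

lemma app_zero [simp]: "app 0 f = 0"
  by (simp add: zero_lin_op.rep_eq)

lemma app_one [simp]: "app 1 f = f"
  by (simp add: one_lin_op.rep_eq)

lemma app_plus [simp]: "app (A + B) f = app A f + app B f"
  by (simp add: plus_lin_op.rep_eq)

lemma app_uminus [simp]: "app (- A) f = - app A f"
  by (simp add: uminus_lin_op.rep_eq)

lemma app_times [simp]: "app (A * B) f = app A (app B f)"
  by (simp add: times_lin_op.rep_eq)

lemma app_add: "app A (f + g) = app A f + app A g"
  using app[of A] by (simp add: is_linear_def)

lemma app_sum: "app (sum A S) f = (\<Sum>i\<in>S. app (A i) f)"
  by (induction S rule: infinite_finite_induct) simp_all

lemma app_annihilation [simp]:
  "app (annihilation n) f = const_poly (of_nat n / 2) * partial n f"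
  by (simp add: annihilation_def)

text \<open>The next lemmas identify \<open>rho_t\<close> as the automorphism with $p_n \mapsto (1 - t^n) p_n$.\<close>

definition rho_weight :: "(nat \<Rightarrow>\<^sub>0 nat) \<Rightarrow> ratfun" where
  "rho_weight m =
     (\<Prod>k\<in>Poly_Mapping.keys m. (1 - t_var ^ (2 * k + 1)) ^ Poly_Mapping.lookup m k)"

lemma rho_weight_superset:
  assumes "finite S" "Poly_Mapping.keys m \<subseteq> S"
  shows "rho_weight m = (\<Prod>k\<in>S. (1 - t_var ^ (2 * k + 1)) ^ Poly_Mapping.lookup m k)"
  unfolding rho_weight_def using assms
  by (intro prod.mono_neutral_left) (auto simp: in_keys_iff)

lemma rho_weight_add: "rho_weight (a + b) = rho_weight a * rho_weight b"
proof -
  let ?S = "Poly_Mapping.keys a \<union> Poly_Mapping.keys b"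
  show ?thesis
    using Poly_Mapping.keys_add[of a b]
    by (simp add: rho_weight_superset[of ?S] lookup_add power_add prod.distrib)
qed

lemma one_minus_t_power_nonzero:
  assumes "n > 0"
  shows "1 - t_var ^ n \<noteq> 0"
proof -
  have "to_fract (x ^ n) = to_fract x ^ n" for x :: "rat poly"
    by (induction n) simp_all
  then have "1 - t_var ^ n = to_fract (1 - [:0, 1:] ^ n)"
    by (simp add: t_var_def)
  moreover have "poly (1 - [:0, 1:] ^ n) (0::rat) = 1"
    using assms by (simp add: poly_power)
  ultimately show ?thesis
    by (metis poly_0 to_fract_eq_0_iff zero_neq_one)
qed

lemma rho_weight_nonzero: "rho_weight m \<noteq> 0"
  using one_minus_t_power_nonzero by (simp add: rho_weight_def del: power_Suc)

lemma rho_factor: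
  "(const_poly (1 - t_var ^ (2 * k + 1)) * psum (2 * k + 1)) ^ e =
   Poly_Mapping.single (Poly_Mapping.single k e) ((1 - t_var ^ (2 * k + 1)) ^ e)"
  by (induction e) (simp_all add: psum_def const_poly_def mult_single flip: single_add)

lemma prod_single:
  "(\<Prod>k\<in>S. Poly_Mapping.single (m k :: nat \<Rightarrow>\<^sub>0 nat) (c k :: ratfun)) =
   Poly_Mapping.single (\<Sum>k\<in>S. m k) (\<Prod>k\<in>S. c k)"
  by (induction S rule: infinite_finite_induct) (simp_all add: mult_single)

lemma sum_single_keys:
  "(\<Sum>k\<in>Poly_Mapping.keys m. Poly_Mapping.single k (Poly_Mapping.lookup m k)) = m"
  by (intro poly_mapping_eqI) (simp add: lookup_sum lookup_single when_def in_keys_iff)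

lemma lookup_rho_t: "Poly_Mapping.lookup (rho_t f) m = rho_weight m * Poly_Mapping.lookup f m"
proof -
  have "rho_t f = (\<Sum>m\<in>Poly_Mapping.keys f.
      Poly_Mapping.single m (rho_weight m * Poly_Mapping.lookup f m))"
    unfolding rho_t_def eval_poly_def rho_factor prod_single sum_single_keys
    by (simp add: const_poly_mult_single rho_weight_def mult.commute)
  then show ?thesis
    by (simp add: lookup_sum lookup_single when_def in_keys_iff)
qed

lemma rho_t_add: "rho_t (f + g) = rho_t f + rho_t g"
  by (intro poly_mapping_eqI) (simp add: lookup_rho_t lookup_add algebra_simps)

lemma rho_t_scale: "rho_t (const_poly c * f) = const_poly c * rho_t f"
  by (intro poly_mapping_eqI) (simp add: lookup_rho_t lookup_const_poly_mult)

lemma rho_t_single: "rho_t (Poly_Mapping.single m c) = Poly_Mapping.single m (rho_weight m * c)"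
  by (intro poly_mapping_eqI) (simp add: lookup_rho_t lookup_single when_def)

lemma sum_single_coeffs:
  "(\<Sum>m\<in>Poly_Mapping.keys f. Poly_Mapping.single m (Poly_Mapping.lookup f m)) =
   (f :: gamma_t)"
  by (intro poly_mapping_eqI) (simp add: lookup_sum lookup_single when_def in_keys_iff)

lemma rho_t_sum: "rho_t (sum F S) = (\<Sum>i\<in>S. rho_t (F i))"
proof (induction S rule: infinite_finite_induct)
  case (infinite S)
  then show ?case by (simp add: rho_t_def eval_poly_def)
next
  case empty
  then show ?case by (simp add: rho_t_def eval_poly_def)
qed (simp add: rho_t_add)

lemma rho_t_mult: "rho_t (f * g) = rho_t f * rho_t g"
proof -
  let ?s = "\<lambda>f m. Poly_Mapping.single m (Poly_Mapping.lookup f m)"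
  have "rho_t (?s f a * ?s g b) = rho_t (?s f a) * rho_t (?s g b)" for a b
    by (simp add: rho_t_single mult_single rho_weight_add mult_ac)
  then have "rho_t (sum (?s f) (Poly_Mapping.keys f) * sum (?s g) (Poly_Mapping.keys g)) =
      rho_t (sum (?s f) (Poly_Mapping.keys f)) * rho_t (sum (?s g) (Poly_Mapping.keys g))"
    by (simp only: rho_t_sum sum_product)
  then show ?thesis by (simp only: sum_single_coeffs)
qed

lemma rho_t_one: "rho_t 1 = 1"
  using rho_t_single[of 0 1] by (simp add: rho_weight_def)

lemma rho_t_psum:
  assumes "odd n"
  shows "rho_t (psum n) = const_poly (1 - t_var ^ n) * psum n"
  using assms by (simp add: psum_def rho_t_single const_poly_mult_single rho_weight_def)

lemma bij_rho_t: "bij rho_t"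
proof (rule bijI)
  show "inj rho_t"
  proof (rule injI)
    fix f g assume "rho_t f = rho_t g"
    then have "rho_weight m * Poly_Mapping.lookup f m = rho_weight m * Poly_Mapping.lookup g m" for m
      by (metis lookup_rho_t)
    then show "f = g"
      using rho_weight_nonzero by (intro poly_mapping_eqI) simp
  qed
  show "surj rho_t"
  proof (rule surjI)
    fix g :: gamma_t
    show "rho_t (\<Sum>m\<in>Poly_Mapping.keys g.
        Poly_Mapping.single m (Poly_Mapping.lookup g m / rho_weight m)) = g"
      using rho_weight_nonzero by (simp add: rho_t_sum rho_t_single sum_single_coeffs)
  qed
qed


section \<open>Vertex operators\<close>

text \<open>
  The exponential of a power series without constant term over an algebra over the field \<open>'k\<close>
  with structure map \<open>s\<close>. The library's \<open>fps_exp\<close> cannot be used, as it divides in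
  the coefficient ring.
\<close>

definition alg_exp :: "('k::field \<Rightarrow> 'a::ring_1) \<Rightarrow> 'a fps \<Rightarrow> 'a fps" where
  "alg_exp s A = Abs_fps (\<lambda>k. s (1 / of_nat (fact k))) oo A"

definition odd_series :: "(nat \<Rightarrow> 'a::ring_1) \<Rightarrow> 'a fps" where
  "odd_series b = Abs_fps (\<lambda>n. if odd n then b n else 0)"

text \<open>
  The coefficient of $z^{-m}$ in $C(z) A(z^{-1})$, applied to \<open>f\<close>; it is the sum over all
  \<open>i, j\<close> with \<open>j - i = - m\<close> of the coefficient of $z^j$ in $C(z)$ composed with the coefficient
  of $z^{-i}$ in $A(z^{-1})$. The sum makes sense when only finitely many coefficients of \<open>A\<close>
  act nontrivially on \<open>f\<close>; see \<open>finite_annihilation_exp\<close> below.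
\<close>

definition normal_product :: "lin_op fps \<Rightarrow> lin_op fps \<Rightarrow> int \<Rightarrow> gamma_t \<Rightarrow> gamma_t" where
  "normal_product C A m f =
     (\<Sum>i | m \<le> int i \<and> app (fps_nth A i) f \<noteq> 0.
        app (fps_nth C (nat (int i - m))) (app (fps_nth A i) f))"

text \<open>The degree of a monomial, with $p_n$ of degree \<open>n\<close>.\<close>

definition odd_degree :: "(nat \<Rightarrow>\<^sub>0 nat) \<Rightarrow> nat" where
  "odd_degree m = (\<Sum>k\<in>Poly_Mapping.keys m. (2 * k + 1) * Poly_Mapping.lookup m k)"

lemma odd_degree_superset:
  assumes "finite S" "Poly_Mapping.keys m \<subseteq> S"
  shows "odd_degree m = (\<Sum>k\<in>S. (2 * k + 1) * Poly_Mapping.lookup m k)"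
  unfolding odd_degree_def using assms
  by (intro sum.mono_neutral_left) (auto simp: in_keys_iff)

lemma odd_degree_add: "odd_degree (a + b) = odd_degree a + odd_degree b"
proof -
  let ?S = "Poly_Mapping.keys a \<union> Poly_Mapping.keys b"
  show ?thesis
    using Poly_Mapping.keys_add[of a b]
    by (simp add: odd_degree_superset[of ?S] lookup_add sum.distrib[symmetric] algebra_simps)
qed

lemma odd_degree_single: "odd_degree (Poly_Mapping.single k 1) = 2 * k + 1"
  by (simp add: odd_degree_def)

definition lowers :: "nat \<Rightarrow> lin_op \<Rightarrow> bool" where
  "lowers n A \<longleftrightarrow> (\<forall>d f. (\<forall>m\<in>Poly_Mapping.keys f. odd_degree m \<le> d) \<longrightarrow>
     (\<forall>m\<in>Poly_Mapping.keys (app A f). odd_degree m + n \<le> d))"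

lemma lowersD:
  assumes "lowers n A" "\<forall>m\<in>Poly_Mapping.keys f. odd_degree m \<le> d"
    and "m \<in> Poly_Mapping.keys (app A f)"
  shows "odd_degree m + n \<le> d"
  using assms unfolding lowers_def by blast

lemma lowers_0: "lowers n 0"
  by (simp add: lowers_def)

lemma lowers_1: "lowers 0 1"
  by (simp add: lowers_def)

lemma lowers_add: "lowers n A \<Longrightarrow> lowers n B \<Longrightarrow> lowers n (A + B)"
  unfolding lowers_def app_plus by (meson Poly_Mapping.keys_add UnE subsetD)

lemma lowers_uminus: "lowers n A \<Longrightarrow> lowers n (- A)"
  by (simp add: lowers_def)

lemma lowers_sum: "(\<And>i. i \<in> S \<Longrightarrow> lowers n (A i)) \<Longrightarrow> lowers n (sum A S)"
  by (induction S rule: infinite_finite_induct) (auto intro: lowers_0 lowers_add)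

lemma lowers_scalar_op: "lowers n A \<Longrightarrow> lowers n (scalar_op c * A)"
  unfolding lowers_def app_times app_scalar_op using keys_const_poly_mult by blast

lemma lowers_mult:
  assumes "lowers a A" "lowers b B"
  shows "lowers (a + b) (A * B)"
  unfolding lowers_def app_times
proof (intro allI impI)
  fix d and f :: gamma_t
  assume *: "\<forall>m\<in>Poly_Mapping.keys f. odd_degree m \<le> d"
  have B: "\<forall>m\<in>Poly_Mapping.keys (app B f). odd_degree m + b \<le> d"
    using assms(2) * by (auto simp: lowers_def)
  then have "\<forall>m\<in>Poly_Mapping.keys (app B f). odd_degree m \<le> d - b"
    by auto
  then have A: "\<forall>m\<in>Poly_Mapping.keys (app A (app B f)). odd_degree m + a \<le> d - b"
    using assms(1) by (auto simp: lowers_def)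
  show "\<forall>m\<in>Poly_Mapping.keys (app A (app B f)). odd_degree m + (a + b) \<le> d"
  proof (cases "app B f = 0")
    case True
    then have "app A (app B f) = 0"
      by (metis add_cancel_right_right app_add)
    then show ?thesis by simp
  next
    case False
    then obtain m where "m \<in> Poly_Mapping.keys (app B f)"
      by (metis all_not_in_conv keys_eq_empty)
    then have "b \<le> d" using B by fastforce
    then show ?thesis using A by fastforce
  qed
qed

lemma lowers_annihilation:
  assumes "odd n"
  shows "lowers n (annihilation n)"
  unfolding annihilation_def
proof (rule lowers_scalar_op, unfold lowers_def app_partial_op, intro allI impI ballI)
  fix d and f :: gamma_t and m
  assume *: "\<forall>m\<in>Poly_Mapping.keys f. odd_degree m \<le> d"
    and "m \<in> Poly_Mapping.keys (partial n f)"
  let ?e = "Poly_Mapping.single (n div 2) (1::nat)"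
  have "m \<in> (\<Union>m\<in>Poly_Mapping.keys f. Poly_Mapping.keys (Poly_Mapping.single (m - ?e)
      (of_nat (Poly_Mapping.lookup m (n div 2)) * Poly_Mapping.lookup f m)))"
    using \<open>m \<in> _\<close> unfolding partial_def by (rule set_mp[OF Poly_Mapping.keys_sum])
  then obtain m' where m': "m' \<in> Poly_Mapping.keys f" "m = m' - ?e"
    "Poly_Mapping.lookup m' (n div 2) \<noteq> 0"
    by (auto split: if_splits)
  have "m' = m + ?e"
    using m' by (intro poly_mapping_eqI) (auto simp: lookup_add lookup_minus lookup_single when_def)
  then have "odd_degree m' = odd_degree m + n"
    using assms by (simp add: odd_degree_add odd_degree_single[unfolded One_nat_def])
  then show "odd_degree m + n \<le> d"
    using * m'(1) by auto
qed

lemma lowers_power: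
  assumes "\<And>n. lowers n (fps_nth A n)"
  shows "lowers n (fps_nth (A ^ k) n)"
proof (induction k arbitrary: n)
  case 0
  then show ?case by (simp add: lowers_0 lowers_1)
next
  case (Suc k)
  have "lowers n (fps_nth A i * fps_nth (A ^ k) (n - i))" if "i \<in> {0..n}" for i
    using lowers_mult[OF assms Suc, of i "n - i"] that by simp
  then show ?case by (auto simp: fps_mult_nth intro: lowers_sum)
qed

lemma finite_lowers:
  assumes low: "\<And>i. lowers i (fps_nth E i)"
  shows "finite {i. app (fps_nth E i) f \<noteq> 0}"
proof -
  obtain d where d: "\<forall>m\<in>Poly_Mapping.keys f. odd_degree m \<le> d"
    using that[of "Max (odd_degree ` Poly_Mapping.keys f)"] by simp
  have "i \<le> d" if "app (fps_nth E i) f \<noteq> 0" for i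
  proof -
    have "Poly_Mapping.keys (app (fps_nth E i) f) \<noteq> {}"
      using that by simp
    then obtain m where "m \<in> Poly_Mapping.keys (app (fps_nth E i) f)"
      by blast
    then have "odd_degree m + i \<le> d"
      by (rule lowersD[OF low d])
    then show ?thesis
      by simp
  qed
  then have "{i. app (fps_nth E i) f \<noteq> 0} \<subseteq> {..d}"
    by blast
  then show ?thesis
    by (rule finite_subset) simp
qed

lemma finite_annihilation_exp:
  "finite {i. app (fps_nth (alg_exp scalar_op
     (- odd_series (\<lambda>n. scalar_op (c n) * annihilation n))) i) f \<noteq> 0}"
proof (rule finite_lowers)
  let ?A = "- odd_series (\<lambda>n. scalar_op (c n) * annihilation n)"
  have "lowers n (fps_nth ?A n)" for n
    by (auto simp: odd_series_def intro!: lowers_uminus lowers_scalar_op lowers_annihilation lowers_0)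
  then show "lowers i (fps_nth (alg_exp scalar_op ?A) i)" for i
    unfolding alg_exp_def fps_compose_nth fps_nth_Abs_fps
    by (intro lowers_sum lowers_scalar_op lowers_power)
qed

text \<open>
  \<open>Phi_mode m\<close> and \<open>Y_mode m\<close> are the coefficients of $z^{-m}$ in $\Phi(z)$ and
  $\mathcal{Y}(z;t)$. The second argument of \<open>normal_product\<close> is a series in $z^{-1}$.
\<close>

definition Phi_mode :: "int \<Rightarrow> gamma_t \<Rightarrow> gamma_t" where
  "Phi_mode = normal_product
     (alg_exp scalar_op (odd_series (\<lambda>n. scalar_op (2 / of_nat n) * creation n)))
     (alg_exp scalar_op (- odd_series (\<lambda>n. scalar_op (2 / of_nat n) * annihilation n)))"

definition Y_mode :: "int \<Rightarrow> gamma_t \<Rightarrow> gamma_t" where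
  "Y_mode = normal_product
     (alg_exp scalar_op
        (odd_series (\<lambda>n. scalar_op (2 * (1 - t_var ^ n) / of_nat n) * creation n)))
     (alg_exp scalar_op
        (- odd_series (\<lambda>n. scalar_op (2 / (of_nat n * (1 - t_var ^ n))) * annihilation n)))"


section \<open>Schur Q-functions and their deformation\<close>

definition strict_partition :: "nat list \<Rightarrow> bool" where
  "strict_partition l \<longleftrightarrow> sorted_wrt (>) l \<and> (\<forall>r\<in>set l. r > 0)"

text \<open>$\mathcal{Y}_{-\lambda_1}(t) \cdots \mathcal{Y}_{-\lambda_\ell}(t) \mathbf{1}$\<close>

definition QY :: "nat list \<Rightarrow> gamma_t" where
  "QY l = foldr (\<lambda>r. Y_mode (- int r)) l 1"

definition q_row :: "nat \<Rightarrow> gamma" where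
  "q_row r = fps_nth (alg_exp const_poly (2 * odd_series (\<lambda>n. const_poly (1 / of_nat n) * psum n))) r"

text \<open>Only meaningful for \<open>r \<ge> s\<close>.\<close>

definition Q2 :: "nat \<Rightarrow> nat \<Rightarrow> gamma" where
  "Q2 r s = (if r = s then 0
     else q_row r * q_row s + 2 * (\<Sum>k=1..s. (-1) ^ k * q_row (r + k) * q_row (s - k)))"

text \<open>
  The Pfaffian of the skew-symmetric matrix \<open>A\<close> of size \<open>2 * n\<close> (rows and columns numbered
  from \<open>0\<close>), as the signed sum over the perfect matchings of the index set. A matching is
  represented by the permutation that lists its pairs $(i_1, j_1), (i_2, j_2), \dots$ with
  $i_r < j_r$ and $i_1 < i_2 < \dots$.
\<close>

definition Pf :: "nat \<Rightarrow> (nat \<Rightarrow> nat \<Rightarrow> 'a::comm_ring_1) \<Rightarrow> 'a" where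
  "Pf n A = (\<Sum>\<sigma> | \<sigma> permutes {..<2 * n} \<and> (\<forall>i<n. \<sigma> (2 * i) < \<sigma> (2 * i + 1)) \<and>
       (\<forall>i j. i < j \<and> j < n \<longrightarrow> \<sigma> (2 * i) < \<sigma> (2 * j)).
     of_int (sign \<sigma>) * (\<Prod>i<n. A (\<sigma> (2 * i)) (\<sigma> (2 * i + 1))))"

definition even_padding :: "nat list \<Rightarrow> nat list" where
  "even_padding l = (if even (length l) then l else l @ [0])"

definition Q_matrix :: "nat list \<Rightarrow> nat \<Rightarrow> nat \<Rightarrow> gamma" where
  "Q_matrix l i j = (if i < j then Q2 (l ! i) (l ! j)
     else if j < i then - Q2 (l ! j) (l ! i) else 0)"

definition schur_Q :: "nat list \<Rightarrow> gamma" where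
  "schur_Q l = Pf (length (even_padding l) div 2) (Q_matrix (even_padding l))"

end

theory Submission
  imports Defs
begin

text \<open>
  The automorphism $\rho_t$ rescales $p_n$ by $1 - t^n$, so conjugation by it multiplies $a_{-n}$
  by $1 - t^n$ and $a_n$ by $(1 - t^n)^{-1}$. Hence it carries the exponents in $\Phi(z)$ to those
  in $\mathcal{Y}(z;t)$, and therefore the exponentials (\<open>alg_exp_intertwine\<close>) and the
  modes (\<open>Y_mode_rho_t\<close>). As $\rho_t$ fixes the unit, it remains to show that
  $\Phi_{-\lambda_1} \cdots \Phi_{-\lambda_\ell} \mathbf{1}$ is the Schur $Q$-function $Q_\lambda$
  defined by a Pfaffian (\<open>extend_scalars_schur_Q\<close>).

  Write $D_i$ for the coefficient of $z^{-i}$ in the annihilation half of $\Phi(z)$, and $\phi_r$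
  for $\Phi_{-r}$. The creation half multiplies by $q(z) = \sum_r q_r z^r$, so
  $\phi_r f = \sum_{i \ge 0} q_{r+i} D_i f$. Apart from
  $D_0 = 1$, commutativity, and $D_i \mathbf{1} = 0$ for $i > 0$, the main input about the $D_i$ is
  \[(z + w) D(z) q(w) = (z - w) q(w) D(z), \qquad D(z) = \sum_i D_i z^{-i},\]
  which is \<open>skew_q\<close> in components. It is derived from the differential equations
  satisfied by the exponentials: $D(z) (q_s f)$ and the product of
  $q_s + 2 \sum_{i \ge 1} (-1)^i q_{s-i} z^{-i}$ with $D(z) f$ solve the same one and have the
  same constant term.

  The Pfaffian comes from expanding along the first row. For a list $u$ of integers let
  $F(u) = \phi_{u_1} \phi_{u_2} \cdots \mathbf{1}$ and let $u - u_j$ be the list without its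
  \<open>j\<close>th entry. With $S_i(u) = \sum_j (-1)^{j-1} q_{u_j - i} F(u - u_j)$, the key formula is
  \[D_i F(u) = 2 (-1)^i S_i(u) \quad (i \ge 1),\]
  proved in \<open>D_contracts\<close> by induction on the length of $u$ and on \<open>i\<close>. The step
  in \<open>i\<close> follows from the exchange relations alone; the case $i = 1$ also uses that the
  alternating sum over two removed entries is antisymmetric. The same computation gives
  $S_0(r, u) = \phi_r (F(u) - S_0(u))$, so that $S_0(u) = F(u)$ for $u$ of odd length. Substituting
  both into $F(r, u) = \sum_i q_{r+i} D_i F(u)$ yields
  \[F(r, u) = \sum_j (-1)^{j-1} F(r, u_j) F(u - u_j)\]
  for $u$ of odd length (\<open>word_expand\<close>). Pfaffians satisfy the same recursion
  (\<open>Pf_Suc\<close>), and $F(r, s) = Q_{(r,s)}$ for $r \neq s$. A partition of odd length is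
  padded by a zero part, which is harmless since $\phi_0 \mathbf{1} = \mathbf{1}$.
\<close>

unbundle fps_syntax


section \<open>Alternating sums over one removed list entry\<close>

text \<open>
  The alternating sum of \<open>H x us\<close> over all ways to remove an entry \<open>x\<close> from the list, where
  \<open>us\<close> is what remains; the first entry has sign \<open>+\<close>.
\<close>

fun remove_sum :: "('b \<Rightarrow> 'b list \<Rightarrow> 'a::ring_1) \<Rightarrow> 'b list \<Rightarrow> 'a" where
  "remove_sum H [] = 0"
| "remove_sum H (x # xs) = H x xs - remove_sum (\<lambda>y ys. H y (x # ys)) xs"

lemma remove_sum_conv_sum:
  "remove_sum H xs = (\<Sum>j<length xs. (-1) ^ j * H (xs ! j) (take j xs @ drop (Suc j) xs))"
proof (induction xs arbitrary: H)
  case (Cons x xs)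
  show ?case
    by (simp add: Cons.IH sum.lessThan_Suc_shift sum_negf del: sum.lessThan_Suc)
qed simp

lemma remove_sum_cong:
  assumes "\<And>s us. s \<in> set xs \<Longrightarrow> set us \<subseteq> set xs \<Longrightarrow> Suc (length us) = length xs \<Longrightarrow> H s us = H' s us"
  shows "remove_sum H xs = remove_sum H' xs"
  unfolding remove_sum_conv_sum
proof (rule sum.cong)
  fix j assume "j \<in> {..<length xs}"
  then show "(-1) ^ j * H (xs ! j) (take j xs @ drop (Suc j) xs) =
      (-1) ^ j * H' (xs ! j) (take j xs @ drop (Suc j) xs)"
    by (subst assms) (auto dest: in_set_takeD in_set_dropD)
qed simp

lemma remove_sum_add:
  "remove_sum (\<lambda>s us. H s us + K s us) xs = remove_sum H xs + remove_sum K xs"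
  by (simp add: remove_sum_conv_sum sum.distrib algebra_simps)

lemma remove_sum_diff:
  "remove_sum (\<lambda>s us. H s us - K s us) xs = remove_sum H xs - remove_sum K xs"
  by (simp add: remove_sum_conv_sum sum_subtractf algebra_simps)

lemma remove_sum_zero: "remove_sum (\<lambda>s us. 0) xs = 0"
  by (simp add: remove_sum_conv_sum)

lemma remove_sum_sum:
  "remove_sum (\<lambda>s us. \<Sum>k\<in>K. H k s us) xs = (\<Sum>k\<in>K. remove_sum (H k) xs)"
  by (simp add: remove_sum_conv_sum sum_distrib_left) (rule sum.swap)

lemma remove_sum_cmult:
  "remove_sum (\<lambda>s us. (c::'a::comm_ring_1) * H s us) xs = c * remove_sum H xs"
  by (simp add: remove_sum_conv_sum sum_distrib_left mult.left_commute)

lemma remove_sum_hom: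
  assumes "\<And>a b. h (a - b) = h a - h b" "h 0 = 0"
  shows "h (remove_sum H xs) = remove_sum (\<lambda>s us. h (H s us)) xs"
  by (induction xs arbitrary: H) (simp_all add: assms)

text \<open>
  Removing the same two entries in the opposite order changes the sign, because removing the
  earlier one first shifts the position of the later one by one.
\<close>

lemma remove_sum_antisym:
  "remove_sum (\<lambda>s us. remove_sum (\<lambda>u vs. K s u vs) us) xs =
   - remove_sum (\<lambda>s us. remove_sum (\<lambda>u vs. K u s vs) us) xs"
proof (induction xs arbitrary: K)
  case (Cons x xs)
  show ?case
    using Cons.IH[of "\<lambda>s u vs. K s u (x # vs)"] by (simp add: remove_sum_diff)
qed simp


section \<open>Words in the modes of a vertex operator\<close>

lemma int_list_bound: obtains N where "\<And>s. s \<in> set rs \<Longrightarrow> s \<le> int N"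
proof -
  have "s \<le> int (nat (Max (set rs)))" if "s \<in> set rs" for s
  proof -
    have "s \<le> Max (set rs)" using that by simp
    then show ?thesis by linarith
  qed
  then show ?thesis using that by blast
qed

text \<open>
  The properties of the neutral vertex operator that force the Pfaffian formula: \<open>q r\<close> is the
  coefficient of $z^r$ in the creation half applied to the unit, and \<open>D i\<close> that of $z^{-i}$
  in the annihilation half. Indices of \<open>q\<close> are integers so that recursions in them need no
  side conditions.
\<close>

locale vertex_system =
  fixes q :: "int \<Rightarrow> 'a::{idom,ring_char_0}" and D :: "nat \<Rightarrow> 'a \<Rightarrow> 'a"
  assumes D_add: "D i (f + g) = D i f + D i g"
    and D_commute: "D i (D j f) = D j (D i f)"
    and D_0: "D 0 f = f"
    and D_one: "i > 0 \<Longrightarrow> D i 1 = 0"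
    and D_finite: "finite {i. D i f \<noteq> 0}"
    and D_q: "D (Suc i) (q s * f) + D i (q (s - 1) * f) = q s * D (Suc i) f - q (s - 1) * D i f"
    and q_neg: "s < 0 \<Longrightarrow> q s = 0"
    and q_0: "q 0 = 1"
begin

text \<open>
  The operator $\phi_r f = \sum_i q_{r+i} D_i f$, that is, the mode of index \<open>- r\<close>.
\<close>

definition phi :: "int \<Rightarrow> 'a \<Rightarrow> 'a" where
  "phi r f = (\<Sum>i | D i f \<noteq> 0. q (r + int i) * D i f)"

text \<open>The product $F(u) = \phi_{u_1} \phi_{u_2} \cdots \mathbf{1}$ for a list \<open>u\<close>.\<close>

abbreviation word :: "int list \<Rightarrow> 'a" where
  "word rs \<equiv> foldr phi rs 1"

text \<open>The alternating sum $S_i(u) = \sum_j (-1)^{j-1} q_{u_j - i} F(u - u_j)$.\<close>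

definition contraction :: "int \<Rightarrow> int list \<Rightarrow> 'a" where
  "contraction i rs = remove_sum (\<lambda>s us. q (s - i) * word us) rs"

lemma D_zero [simp]: "D i 0 = 0"
  using D_add[of i 0 0] by simp

lemma D_diff: "D i (f - g) = D i f - D i g"
  using D_add[of i "f - g" g] by (simp add: eq_diff_eq)

lemma D_sum: "D i (sum f A) = (\<Sum>x\<in>A. D i (f x))"
  by (induction A rule: infinite_finite_induct) (simp_all add: D_add)

lemma phi_eq:
  assumes "\<And>i. i > N \<Longrightarrow> D i f = 0"
  shows "phi r f = (\<Sum>i\<le>N. q (r + int i) * D i f)"
  unfolding phi_def using assms
  by (intro sum.mono_neutral_left) (auto simp: not_less[symmetric])

lemma D_bound:
  assumes "finite A"
  obtains N where "\<And>i f. f \<in> A \<Longrightarrow> i > N \<Longrightarrow> D i f = 0"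
proof -
  have "finite (\<Union>f\<in>A. {i. D i f \<noteq> 0})"
    using assms D_finite by blast
  then obtain N where "\<forall>i\<in>(\<Union>f\<in>A. {i. D i f \<noteq> 0}). i \<le> N"
    using finite_nat_set_iff_bounded_le by meson
  then show ?thesis
    by (intro that[of N]) force
qed

lemma phi_zero [simp]: "phi r 0 = 0"
  by (simp add: phi_def)

lemma phi_diff: "phi r (f - g) = phi r f - phi r g"
proof -
  obtain N where "\<And>i h. h \<in> {f, g, f - g} \<Longrightarrow> i > N \<Longrightarrow> D i h = 0"
    using D_bound[of "{f, g, f - g}"] by blast
  then show ?thesis
    by (simp add: phi_eq[of N] D_diff sum_subtractf algebra_simps)
qed

text \<open>
  The components of $(w + z) D(w) \phi(z) = (w - z) \phi(z) D(w)$, where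
  $\phi(z) = \sum_r \phi_r z^r$.
\<close>

lemma D_phi:
  "D (Suc i) (phi r f) + D i (phi (r - 1) f) = phi r (D (Suc i) f) - phi (r - 1) (D i f)"
proof -
  obtain N where N: "\<And>i h. h \<in> {f} \<Longrightarrow> i > N \<Longrightarrow> D i h = 0"
    using D_bound[of "{f}"] by blast
  then have N': "D a (D i f) = 0" if "a > N" for a i
    using that by (subst D_commute) simp
  have phi_f: "phi r f = (\<Sum>a\<le>N. q (r + int a) * D a f)" for r
    using N by (intro phi_eq) simp
  have phi_D: "phi r (D i f) = (\<Sum>a\<le>N. q (r + int a) * D i (D a f))" for r i
    using N' by (subst phi_eq[of N]) (simp_all add: D_commute[of i])
  have "D (Suc i) (phi r f) + D i (phi (r - 1) f) = (\<Sum>a\<le>N.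
      D (Suc i) (q (r + int a) * D a f) + D i (q (r + int a - 1) * D a f))"
    by (simp add: phi_f D_sum sum.distrib algebra_simps)
  also have "\<dots> = phi r (D (Suc i) f) - phi (r - 1) (D i f)"
    by (simp only: D_q) (simp add: phi_D sum_subtractf algebra_simps)
  finally show ?thesis .
qed

text \<open>The components of $(z + w) \phi(z) q(w) = (z - w) q(w) \phi(z)$.\<close>

lemma phi_q:
  "phi (r - 1) (q s * f) + phi r (q (s - 1) * f) = q s * phi (r - 1) f - q (s - 1) * phi r f"
proof -
  obtain N where N: "\<And>i h. h \<in> {f, q s * f, q (s - 1) * f} \<Longrightarrow> i > N \<Longrightarrow> D i h = 0"
    using D_bound[of "{f, q s * f, q (s - 1) * f}"] by blast
  let ?H = "{f, q s * f, q (s - 1) * f}"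
  have phi: "phi r h = (\<Sum>a\<le>N. q (r + int a) * D a h)" if "h \<in> ?H" for h
    using N[OF that] by (rule phi_eq)
  have shift: "phi (r - 1) h = q (r - 1) * h + (\<Sum>a\<le>N. q (r + int a) * D (Suc a) h)"
    if "h \<in> ?H" for h
  proof -
    have "phi (r - 1) h = (\<Sum>a\<le>Suc N. q (r - 1 + int a) * D a h)"
      using N[OF that] by (intro phi_eq) simp
    then show ?thesis
      by (simp add: sum.atMost_Suc_shift D_0 add.commute del: sum.atMost_Suc)
  qed
  have "phi (r - 1) (q s * f) + phi r (q (s - 1) * f) =
      q (r - 1) * (q s * f) + (\<Sum>a\<le>N. q (r + int a) *
        (D (Suc a) (q s * f) + D a (q (s - 1) * f)))"
    by (subst shift, simp, subst phi, simp) (simp add: sum.distrib distrib_left add.assoc)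
  also have "\<dots> = q s * (q (r - 1) * f + (\<Sum>a\<le>N. q (r + int a) * D (Suc a) f)) -
      q (s - 1) * (\<Sum>a\<le>N. q (r + int a) * D a f)"
    by (simp only: D_q) (simp add: sum_subtractf sum_distrib_left algebra_simps)
  finally show ?thesis
    by (simp add: shift phi)
qed

text \<open>
  The expansion of $q(w) \phi(z) + \phi(z) q(w) = 2 (1 + w/z)^{-1} q(w) \phi(z)$ in powers of
  $w/z$; the terms with $k > s$ vanish.
\<close>

lemma phi_q_sym:
  assumes "s \<le> int K"
  shows "q s * phi r f + phi r (q s * f) =
    2 * (\<Sum>k\<le>K. (-1) ^ k * q (s - int k) * phi (r + int k) f)"
  using assms
proof (induction K arbitrary: r s)
  case 0
  have "q (s - 1) = 0" using 0 by (simp add: q_neg)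
  then show ?case
    using phi_q[of "r + 1" s f] by simp
next
  case (Suc K)
  have "q s * phi r f + phi r (q s * f) =
      2 * q s * phi r f - (q (s - 1) * phi (r + 1) f + phi (r + 1) (q (s - 1) * f))"
    using phi_q[of "r + 1" s f] by (simp add: algebra_simps)
  also have "q (s - 1) * phi (r + 1) f + phi (r + 1) (q (s - 1) * f) =
      2 * (\<Sum>k\<le>K. (-1) ^ k * q (s - 1 - int k) * phi (r + 1 + int k) f)"
    using Suc.prems by (intro Suc.IH) simp
  finally show ?case
    by (simp add: sum.atMost_Suc_shift sum_negf algebra_simps del: sum.atMost_Suc)
qed

lemma contraction_Cons: "contraction i (r # rs) = q (r - i) * word rs - remove_sum (\<lambda>s us. q (s - i) * phi r (word us)) rs"
  by (simp add: contraction_def)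

lemma contraction_eq_0:
  assumes "\<And>s. s \<in> set rs \<Longrightarrow> s < i"
  shows "contraction i rs = 0"
proof -
  have "contraction i rs = remove_sum (\<lambda>s us. 0) rs"
    unfolding contraction_def by (rule remove_sum_cong) (simp add: assms q_neg)
  then show ?thesis by (simp add: remove_sum_zero)
qed

lemma phi_contraction: "phi r (contraction i rs) = remove_sum (\<lambda>s us. phi r (q (s - i) * word us)) rs"
  unfolding contraction_def by (rule remove_sum_hom) (simp_all add: phi_diff)

text \<open>
  The exchange relation between \<open>phi\<close> and \<open>q\<close>, summed over the removed entry, turns a mode
  acting on a contraction into a contraction of a longer word.
\<close>

lemma phi_contraction_rec:
  "phi r (contraction (i + 1) rs) + phi (r - 1) (contraction i rs) = contraction (i + 1) (r # rs) - contraction i ((r - 1) # rs)"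
proof -
  have "phi r (contraction (i + 1) rs) + phi (r - 1) (contraction i rs) =
      remove_sum (\<lambda>s us. phi (r - 1) (q (s - i) * word us) + phi r (q (s - i - 1) * word us)) rs"
    by (simp add: phi_contraction remove_sum_add diff_diff_eq add.commute)
  also have "\<dots> = remove_sum (\<lambda>s us. q (s - i) * phi (r - 1) (word us)) rs -
      remove_sum (\<lambda>s us. q (s - i - 1) * phi r (word us)) rs"
    by (simp add: phi_q remove_sum_diff)
  finally show ?thesis
    by (simp add: contraction_Cons diff_diff_eq algebra_simps)
qed

text \<open>
  The property that each \<open>D i\<close> with $i \ge 1$ acts on the word of \<open>rs\<close> as $2 (-1)^i$ times
  the contraction $S_i$; it is shown below to hold for every list.
\<close>

definition D_contracts :: "int list \<Rightarrow> bool" where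
  "D_contracts rs \<longleftrightarrow> (\<forall>i. D (Suc i) (word rs) = 2 * (-1) ^ Suc i * contraction (int (Suc i)) rs)"

lemma phi_word:
  assumes "D_contracts rs" and "\<And>s. s \<in> set rs \<Longrightarrow> s \<le> int N"
  shows "phi r (word rs) = q r * word rs +
    2 * (\<Sum>a\<le>N. (-1) ^ Suc a * q (r + int (Suc a)) * contraction (int (Suc a)) rs)"
proof -
  have "D i (word rs) = 0" if "i > Suc N" for i
  proof (cases i)
    case (Suc j)
    have "contraction (int (Suc j)) rs = 0"
      using assms(2) that Suc by (intro contraction_eq_0) fastforce
    then show ?thesis using assms(1) Suc by (simp add: D_contracts_def)
  qed (use that in simp)
  then have "phi r (word rs) = (\<Sum>i\<le>Suc N. q (r + int i) * D i (word rs))"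
    by (intro phi_eq) simp
  then show ?thesis
    using assms(1) by (simp add: sum.atMost_Suc_shift D_contracts_def D_0 sum_distrib_left mult_ac
      del: sum.atMost_Suc of_nat_Suc power_Suc)
qed

text \<open>
  The one step of the induction that uses antisymmetry. Moving $\phi_r$ past the factors
  $q_{s-1}$ and expanding $\phi_{r+k}$ on the shorter words produces a sum over single removed
  entries, which reassembles to $q_{r-1} F(u) - \phi_{r-1} F(u)$, and a sum \<open>Z\<close> over two removed
  entries, which vanishes.
\<close>

lemma D_contracts_base:
  assumes rs: "D_contracts rs"
    and us: "\<And>us. Suc (length us) = length rs \<Longrightarrow> D_contracts us"
  shows "phi r (contraction 1 rs) + phi (r - 1) (word rs) = contraction 1 (r # rs)"
proof -
  obtain N where N: "\<And>s. s \<in> set rs \<Longrightarrow> s \<le> int N"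
    using int_list_bound by blast
  define T where "T k a = remove_sum (\<lambda>s us. q (s - int (Suc k)) * contraction (int (Suc a)) us) rs" for k a
  have T: "T k a = - T a k" for k a
  proof -
    have "T k a = remove_sum (\<lambda>s us. remove_sum (\<lambda>u vs.
        q (s - int (Suc k)) * (q (u - int (Suc a)) * word vs)) us) rs" for k a
      by (simp add: T_def contraction_def remove_sum_cmult)
    note T_conv = this
    show ?thesis
      unfolding T_conv by (subst remove_sum_antisym) (simp only: mult.left_commute)
  qed
  define Z where "Z = (\<Sum>k\<le>N. \<Sum>a\<le>N. (-1) ^ (k + a) * q (r + int k + int (Suc a)) * T k a)"
  \<comment> \<open>The coefficient of \<open>T k a\<close> is symmetric in \<open>k\<close> and \<open>a\<close>.\<close>
  have "Z = (\<Sum>a\<le>N. \<Sum>k\<le>N. (-1) ^ (k + a) * q (r + int k + int (Suc a)) * T k a)"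
    unfolding Z_def by (rule sum.swap)
  also have "\<dots> = (\<Sum>a\<le>N. \<Sum>k\<le>N. - ((-1) ^ (a + k) * q (r + int a + int (Suc k)) * T a k))"
    by (intro sum.cong refl) (subst T, simp add: algebra_simps)
  also have "\<dots> = - Z"
    by (simp add: Z_def sum_negf)
  finally have "Z = 0"
    by simp
  have expand: "2 * (\<Sum>k\<le>N. (-1) ^ k * (x k * (y k * f + 2 * (\<Sum>a\<le>N. (-1) ^ Suc a * z k a * g a)))) =
      2 * (\<Sum>k\<le>N. (-1) ^ k * y k * (x k * f)) -
      4 * (\<Sum>k\<le>N. \<Sum>a\<le>N. (-1) ^ (k + a) * z k a * (x k * g a))"
    for f :: 'a and x y g and z :: "nat \<Rightarrow> nat \<Rightarrow> 'a"
  proof -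
    have "2 * (2 * y) = 4 * y" for y :: 'a by simp
    then show ?thesis
      by (simp add: right_diff_distrib sum_subtractf sum_distrib_left sum_negf power_add mult_ac)
  qed
  have "phi r (contraction 1 rs) + remove_sum (\<lambda>s us. q (s - 1) * phi r (word us)) rs =
      remove_sum (\<lambda>s us. q (s - 1) * phi r (word us) + phi r (q (s - 1) * word us)) rs"
    by (simp add: phi_contraction remove_sum_add)
  also have "\<dots> = remove_sum (\<lambda>s us. 2 * (\<Sum>k\<le>N. (-1) ^ k * (q (s - int (Suc k)) *
      phi (r + int k) (word us)))) rs"
    by (rule remove_sum_cong, subst phi_q_sym[of _ N]) (auto dest: N simp: algebra_simps)
  also have "\<dots> = remove_sum (\<lambda>s us. 2 * (\<Sum>k\<le>N. (-1) ^ k * (q (s - int (Suc k)) *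
      (q (r + int k) * word us + 2 * (\<Sum>a\<le>N. (-1) ^ Suc a * q (r + int k + int (Suc a)) *
        contraction (int (Suc a)) us))))) rs"
    by (rule remove_sum_cong, subst phi_word[of _ N]) (auto dest: N us)
  also have "\<dots> = remove_sum (\<lambda>s us. 2 * (\<Sum>k\<le>N. (-1) ^ k * q (r + int k) *
      (q (s - int (Suc k)) * word us)) - 4 * (\<Sum>k\<le>N. \<Sum>a\<le>N.
        (-1) ^ (k + a) * q (r + int k + int (Suc a)) *
        (q (s - int (Suc k)) * contraction (int (Suc a)) us))) rs"
    by (simp only: expand)
  also have "\<dots> = 2 * (\<Sum>k\<le>N. (-1) ^ k * q (r + int k) * contraction (int (Suc k)) rs) - 4 * Z"
    by (simp add: remove_sum_diff remove_sum_cmult remove_sum_sum contraction_def[symmetric] T_def[symmetric]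
      Z_def del: of_nat_Suc)
  also have "\<dots> = q (r - 1) * word rs - phi (r - 1) (word rs)"
    by (subst phi_word[OF rs N]) (simp_all add: \<open>Z = 0\<close> sum_negf)
  finally show ?thesis
    by (simp add: contraction_Cons algebra_simps)
qed

text \<open>
  The relation \<open>D_phi\<close> determines \<open>D (Suc i)\<close> on a longer word from \<open>D i\<close> and the
  shorter word, which gives an induction on \<open>i\<close> that starts at $i = 1$.
\<close>

lemma D_contracts_Cons:
  assumes rs: "D_contracts rs"
    and us: "\<And>us. Suc (length us) = length rs \<Longrightarrow> D_contracts us"
  shows "D_contracts (r # rs)"
proof -
  have "D (Suc i) (phi r (word rs)) = 2 * (-1) ^ Suc i * contraction (int (Suc i)) (r # rs)" for i r
  proof (induction i arbitrary: r)
    case 0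
    have "D 1 (phi r (word rs)) = phi r (D 1 (word rs)) - 2 * phi (r - 1) (word rs)"
      using D_phi[of 0 r "word rs"] by (simp add: D_0 algebra_simps)
    also have "D 1 (word rs) = 0 - contraction 1 rs - contraction 1 rs"
      using rs by (simp add: D_contracts_def)
    also have "phi r \<dots> = - 2 * phi r (contraction 1 rs)"
      by (simp only: phi_diff phi_zero) simp
    finally show ?case
      unfolding int_ops(2) One_nat_def[symmetric] by (simp add: D_contracts_base[OF rs us, symmetric] algebra_simps)
  next
    case (Suc i)
    have scale: "phi r (2 * (-1) ^ k * f) = 2 * (-1) ^ k * phi r f" for k r f
    proof -
      have double: "phi r (2 * f) = 2 * phi r f" for f
        using phi_diff[of r "2 * f" f] by (simp add: algebra_simps)
      have neg: "phi r (- f) = - phi r f" for f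
        using phi_diff[of r 0 f] by simp
      show ?thesis
        by (cases "even k") (simp_all add: double neg)
    qed
    have "D (Suc (Suc i)) (phi r (word rs)) = phi r (D (Suc (Suc i)) (word rs)) -
        phi (r - 1) (D (Suc i) (word rs)) - D (Suc i) (phi (r - 1) (word rs))"
      using D_phi[of "Suc i" r "word rs"] by (simp add: algebra_simps)
    also have "\<dots> = 2 * (-1) ^ Suc (Suc i) * (phi r (contraction (int (Suc i) + 1) rs) +
        phi (r - 1) (contraction (int (Suc i)) rs) + contraction (int (Suc i)) ((r - 1) # rs))"
      using rs Suc.IH by (simp only: D_contracts_def scale) (simp add: algebra_simps)
    also have "\<dots> = 2 * (-1) ^ Suc (Suc i) * contraction (int (Suc (Suc i))) (r # rs)"
      by (simp only: phi_contraction_rec) (simp add: algebra_simps)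
    finally show ?case .
  qed
  then show ?thesis
    by (simp add: D_contracts_def)
qed

lemma D_contracts: "D_contracts rs"
proof (induction "length rs" arbitrary: rs rule: less_induct)
  case less
  show ?case
  proof (cases rs)
    case Nil
    then show ?thesis by (simp add: D_contracts_def contraction_def D_one)
  next
    case (Cons r rs')
    then show ?thesis using less by (auto intro!: D_contracts_Cons)
  qed
qed

text \<open>
  Comparing \<open>phi_contraction_rec\<close> at $i = 0$ with \<open>D_contracts_base\<close> gives
  $S_0(r, u) = \phi_r (F(u) - S_0(u))$.
\<close>

lemma contraction_0: "contraction 0 rs = (if odd (length rs) then word rs else 0)"
proof (induction rs)
  case Nil
  then show ?case by (simp add: contraction_def)
next
  case (Cons r rs)
  have "contraction 0 (r # rs) + phi r (contraction 0 rs) + phi (r + 1) (contraction 1 rs) =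
      phi r (word rs) + phi (r + 1) (contraction 1 rs)"
    using phi_contraction_rec[of "r + 1" 0 rs] D_contracts_base[of rs "r + 1"] D_contracts
    by (simp add: algebra_simps)
  then have "contraction 0 (r # rs) = phi r (word rs - contraction 0 rs)"
    by (simp add: phi_diff algebra_simps)
  then show ?case
    by (simp add: Cons.IH)
qed

lemma word_two:
  assumes "s \<le> int N"
  shows "word [r, s] = q r * q s + 2 * (\<Sum>k\<le>N. (-1) ^ Suc k * q (r + int (Suc k)) * q (s - int (Suc k)))"
proof -
  have one: "phi s 1 = q s" for s
    by (subst phi_eq[of 0]) (simp_all add: D_one D_0)
  show ?thesis
    using phi_word[of "[s]" N r] assms D_contracts by (simp add: one contraction_def)
qed

text \<open>The Pfaffian expansion of a word of even length along its first letter.\<close>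

theorem word_expand:
  assumes "odd (length rs)"
  shows "word (r # rs) = remove_sum (\<lambda>s us. word [r, s] * word us) rs"
proof -
  obtain N where N: "\<And>s. s \<in> set rs \<Longrightarrow> s \<le> int N"
    using int_list_bound by blast
  have "remove_sum (\<lambda>s us. word [r, s] * word us) rs = remove_sum (\<lambda>s us. q r * (q (s - 0) * word us) +
      2 * (\<Sum>k\<le>N. (-1) ^ Suc k * q (r + int (Suc k)) * (q (s - int (Suc k)) * word us))) rs"
    by (rule remove_sum_cong, subst word_two[OF N])
      (simp_all add: left_diff_distrib sum_distrib_right sum_negf mult.assoc del: of_nat_Suc)
  also have "\<dots> = q r * contraction 0 rs +
      2 * (\<Sum>k\<le>N. (-1) ^ Suc k * q (r + int (Suc k)) * contraction (int (Suc k)) rs)"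
    by (simp only: remove_sum_add remove_sum_cmult remove_sum_sum contraction_def)
  also have "\<dots> = phi r (word rs)"
    using assms phi_word[OF D_contracts N, of rs r] by (simp add: contraction_0 del: of_nat_Suc)
  finally show ?thesis by simp
qed

lemma word_append_0: "word (rs @ [0]) = word rs"
proof -
  have "phi 0 1 = 1"
    by (subst phi_eq[of 0]) (simp_all add: D_one D_0 q_0)
  then show ?thesis by simp
qed

end


section \<open>Expansion of a Pfaffian along its first row\<close>

text \<open>
  The perfect matchings of $\{0, \dots, 2n - 1\}$, as the permutations over which the Pfaffian
  is summed.
\<close>
definition matchings :: "nat \<Rightarrow> (nat \<Rightarrow> nat) set" where
  "matchings n = {\<sigma>. \<sigma> permutes {..<2 * n} \<and> (\<forall>i<n. \<sigma> (2 * i) < \<sigma> (2 * i + 1)) \<and>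
     (\<forall>i j. i < j \<and> j < n \<longrightarrow> \<sigma> (2 * i) < \<sigma> (2 * j))}"

lemma Pf_matchings:
  "Pf n A = (\<Sum>\<sigma>\<in>matchings n. of_int (sign \<sigma>) * (\<Prod>i<n. A (\<sigma> (2 * i)) (\<sigma> (2 * i + 1))))"
  by (simp add: Pf_def matchings_def)

text \<open>
  The permutation that fixes 0, sends 1 to \<open>j\<close>, and sends $2, 3, \dots$ increasingly to the
  positive numbers other than \<open>j\<close>. It is a cycle of length \<open>j\<close>.
\<close>

definition skip_cycle :: "nat \<Rightarrow> nat \<Rightarrow> nat" where
  "skip_cycle j x = (if x = 0 \<or> j < x then x else if x = 1 then j else x - 1)"

lemma skip_cycle_permutes_sign:
  "skip_cycle (Suc k) permutes {..<Suc (Suc k)} \<and> sign (skip_cycle (Suc k)) = (- 1) ^ k"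
proof (induction k)
  case 0
  have "skip_cycle (Suc 0) = id"
    by (auto simp: skip_cycle_def fun_eq_iff)
  then show ?case by (simp only: permutes_id sign_id) simp
next
  case (Suc k)
  \<comment> \<open>Moving the image of 1 one step up costs one adjacent transposition.\<close>
  have eq: "skip_cycle (Suc (Suc k)) = transpose (Suc k) (Suc (Suc k)) \<circ> skip_cycle (Suc k)"
    by (auto simp: skip_cycle_def fun_eq_iff transpose_def)
  have t: "transpose (Suc k) (Suc (Suc k)) permutes {..<Suc (Suc (Suc k))}"
    by (intro permutes_swap_id) auto
  have s: "skip_cycle (Suc k) permutes {..<Suc (Suc (Suc k))}"
    by (rule permutes_subset[of _ "{..<Suc (Suc k)}"]) (use Suc in auto)
  have "permutation (transpose (Suc k) (Suc (Suc k)))" "permutation (skip_cycle (Suc k))"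
    using t s by (auto simp: permutation_permutes)
  then have "sign (skip_cycle (Suc (Suc k))) = (- 1) ^ Suc k"
    unfolding eq using Suc by (simp only: sign_compose sign_swap_id) simp
  moreover have "skip_cycle (Suc (Suc k)) permutes {..<Suc (Suc (Suc k))}"
    unfolding eq by (rule permutes_compose[OF s t])
  ultimately show ?case by blast
qed

text \<open>
  The copy of a permutation of $\{0, \dots, 2n - 1\}$ on $\{2, \dots, 2n + 1\}$.
\<close>

definition shift_perm :: "nat \<Rightarrow> (nat \<Rightarrow> nat) \<Rightarrow> nat \<Rightarrow> nat" where
  "shift_perm n \<tau> = map_permutation {..<2 * n} (\<lambda>x. x + 2) \<tau>"

lemma shift_perm_image: "(\<lambda>x. x + 2) ` {..<2 * n} = {2..<2 * Suc n}" for n :: nat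
  unfolding lessThan_atLeast0 image_add_atLeastLessThan' by (simp add: numeral_2_eq_2)

lemma shift_perm:
  assumes "\<tau> permutes {..<2 * n}"
  shows "shift_perm n \<tau> permutes {2..<2 * Suc n}" "sign (shift_perm n \<tau>) = sign \<tau>"
    "x < 2 * n \<Longrightarrow> shift_perm n \<tau> (x + 2) = \<tau> x + 2"
    "x < 2 \<Longrightarrow> shift_perm n \<tau> x = x"
proof -
  show *: "shift_perm n \<tau> permutes {2..<2 * Suc n}"
    unfolding shift_perm_def
    by (rule map_permutation_permutes[OF _ assms])
      (unfold bij_betw_def shift_perm_image, auto simp: inj_on_def)
  show "sign (shift_perm n \<tau>) = sign \<tau>"
    unfolding shift_perm_def by (rule sign_map_permutation) (use assms in \<open>auto simp: inj_on_def\<close>)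
  show "shift_perm n \<tau> (x + 2) = \<tau> x + 2" if "x < 2 * n"
    unfolding shift_perm_def
    by (rule map_permutation_apply[of "\<lambda>x. x + 2"]) (use that in \<open>auto simp: inj_on_def\<close>)
  show "shift_perm n \<tau> x = x" if "x < 2"
    using * that by (auto simp: permutes_def)
qed

text \<open>
  The matching that consists of the pair \<open>(0, k + 1)\<close> and of \<open>\<tau>\<close> transported to the other
  numbers.
\<close>

definition insert_pair :: "nat \<Rightarrow> nat \<Rightarrow> (nat \<Rightarrow> nat) \<Rightarrow> nat \<Rightarrow> nat" where
  "insert_pair n k \<tau> = skip_cycle (Suc k) \<circ> shift_perm n \<tau>"

lemma skip_cycle_mono: "2 \<le> x \<Longrightarrow> x < y \<Longrightarrow> skip_cycle (Suc k) x < skip_cycle (Suc k) y"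
  by (auto simp: skip_cycle_def)

lemma skip_cycle_permutes: 
  assumes "k < 2 * n + 1"
  shows "skip_cycle (Suc k) permutes {..<2 * Suc n}"
  by (rule permutes_subset[of _ "{..<Suc (Suc k)}"]) (use skip_cycle_permutes_sign assms in auto)

lemma insert_pair:
  assumes "\<tau> permutes {..<2 * n}" "k < 2 * n + 1"
  shows "insert_pair n k \<tau> permutes {..<2 * Suc n}"
    "sign (insert_pair n k \<tau>) = (-1) ^ k * sign \<tau>"
    "insert_pair n k \<tau> 0 = 0" "insert_pair n k \<tau> 1 = Suc k"
    "x < 2 * n \<Longrightarrow> insert_pair n k \<tau> (x + 2) = skip_cycle (Suc k) (\<tau> x + 2)"
proof -
  note sh = shift_perm[OF assms(1)] and sk = skip_cycle_permutes[OF assms(2)]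
  have sh': "shift_perm n \<tau> permutes {..<2 * Suc n}"
    by (rule permutes_subset[OF sh(1)]) auto
  show "insert_pair n k \<tau> permutes {..<2 * Suc n}"
    unfolding insert_pair_def by (rule permutes_compose[OF sh' sk])
  have "permutation (skip_cycle (Suc k))" "permutation (shift_perm n \<tau>)"
    using sh' sk by (auto simp: permutation_permutes)
  then show "sign (insert_pair n k \<tau>) = (-1) ^ k * sign \<tau>"
    by (simp add: insert_pair_def sign_compose sh(2) skip_cycle_permutes_sign)
qed (use shift_perm[OF assms(1)] in \<open>auto simp: insert_pair_def skip_cycle_def\<close>)

lemma insert_pair_matching:
  assumes "\<tau> \<in> matchings n" "k < 2 * n + 1"
  shows "insert_pair n k \<tau> \<in> matchings (Suc n)"
proof -
  have \<tau>: "\<tau> permutes {..<2 * n}" using assms by (simp add: matchings_def)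
  note ins = insert_pair[OF \<tau> assms(2)]
  have shifted: "insert_pair n k \<tau> (2 * Suc i) = skip_cycle (Suc k) (\<tau> (2 * i) + 2)"
    "insert_pair n k \<tau> (2 * Suc i + 1) = skip_cycle (Suc k) (\<tau> (2 * i + 1) + 2)" if "i < n" for i
    using ins(5)[of "2 * i"] ins(5)[of "2 * i + 1"] that by simp_all
  show ?thesis
    unfolding matchings_def mem_Collect_eq
  proof (intro conjI allI impI ins(1))
    fix i assume "i < Suc n"
    then show "insert_pair n k \<tau> (2 * i) < insert_pair n k \<tau> (2 * i + 1)"
    proof (cases i)
      case 0
      then show ?thesis using ins(3,4) by simp
    next
      case (Suc m)
      then have "m < n" using \<open>i < Suc n\<close> by simp
      then show ?thesis
        unfolding Suc shifted[OF \<open>m < n\<close>]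
        using assms(1) by (intro skip_cycle_mono) (auto simp: matchings_def)
    qed
  next
    fix i j assume "i < j \<and> j < Suc n"
    then obtain l where l: "j = Suc l" "l < n" by (cases j) auto
    show "insert_pair n k \<tau> (2 * i) < insert_pair n k \<tau> (2 * j)"
    proof (cases i)
      case 0
      then show ?thesis
        unfolding l shifted[OF l(2)] using ins(3) by (simp add: skip_cycle_def)
    next
      case (Suc m)
      then have "m < l" "m < n" using \<open>i < j \<and> j < Suc n\<close> l by simp_all
      then show ?thesis
        unfolding Suc l shifted[OF \<open>m < n\<close>] shifted[OF l(2)]
        using assms(1) l by (intro skip_cycle_mono) (auto simp: matchings_def)
    qed
  qed
qed

lemma matchings_at_0:
  assumes "\<sigma> \<in> matchings (Suc n)"
  shows "\<sigma> 0 = 0"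
proof -
  have \<sigma>: "\<sigma> permutes {..<2 * Suc n}" using assms by (simp add: matchings_def)
  then obtain p where p: "p < 2 * Suc n" "\<sigma> p = 0"
    using permutes_image[OF \<sigma>] by (metis (no_types, lifting) imageE lessThan_iff zero_less_Suc
        mult_2 add_Suc)
  have "p = 0"
  proof (cases "even p")
    case True
    then obtain i where "p = 2 * i" by (rule evenE)
    moreover have "\<sigma> (2 * 0) < \<sigma> (2 * i)" if "i > 0"
      using assms that p \<open>p = 2 * i\<close> unfolding matchings_def by force
    ultimately show ?thesis
      using p by fastforce
  next
    case False
    then obtain i where "p = 2 * i + 1" by (auto elim: oddE)
    then have "i < Suc n" using p by simp
    then have "\<sigma> (2 * i) < \<sigma> (2 * i + 1)" using assms unfolding matchings_def by blast
    then show ?thesis using p \<open>p = 2 * i + 1\<close> by simp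
  qed
  then show ?thesis using p by simp
qed

text \<open>
  In a matching, 0 is the head of the first pair. Undoing \<open>skip_cycle\<close> for the partner of 0
  leaves a permutation that fixes 0 and 1.
\<close>

lemma matchings_surj:
  assumes "\<sigma> \<in> matchings (Suc n)"
  obtains k \<tau> where "k < 2 * n + 1" "\<tau> \<in> matchings n" "\<sigma> = insert_pair n k \<tau>"
proof -
  have \<sigma>: "\<sigma> permutes {..<2 * Suc n}" using assms by (simp add: matchings_def)
  have pairs: "\<sigma> (2 * i) < \<sigma> (2 * i + 1)" if "i < Suc n" for i
    using assms that unfolding matchings_def by blast
  have heads: "\<sigma> (2 * i) < \<sigma> (2 * j)" if "i < j" "j < Suc n" for i j
    using assms that unfolding matchings_def by blast
  have \<sigma>0: "\<sigma> 0 = 0" by (rule matchings_at_0[OF assms])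
  have "\<sigma> 1 > 0" using pairs[of 0] \<sigma>0 by simp
  then obtain k where k: "\<sigma> 1 = Suc k" by (cases "\<sigma> 1") auto
  have "\<sigma> 1 < 2 * Suc n" using permutes_in_image[OF \<sigma>, of 1] by simp
  then have "k < 2 * n + 1" using k by simp
  note sk = skip_cycle_permutes[OF this]
  define \<pi> where "\<pi> = inv (skip_cycle (Suc k)) \<circ> \<sigma>"
  have \<pi>: "\<pi> permutes {..<2 * Suc n}"
    unfolding \<pi>_def by (rule permutes_compose[OF \<sigma> permutes_inv[OF sk]])
  have \<sigma>_\<pi>: "\<sigma> x = skip_cycle (Suc k) (\<pi> x)" for x
    by (simp add: \<pi>_def permutes_inverses[OF sk])
  have \<pi>01: "\<pi> 0 = 0" "\<pi> 1 = 1"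
    unfolding \<pi>_def comp_def permutes_inv_eq[OF sk] \<sigma>0 k by (simp_all add: skip_cycle_def)
  have \<pi>': "\<pi> permutes {2..<2 * Suc n}"
    by (rule permutes_superset[OF \<pi>]) (use \<pi>01 in \<open>auto simp: not_le less_2_cases_iff\<close>)
  define \<tau> where "\<tau> = map_permutation {2..<2 * Suc n} (\<lambda>x. x - 2) \<pi>"
  have img: "(\<lambda>x. x - 2) ` {2..<2 * Suc n} = {..<2 * n}"
    by (force simp: image_iff intro: bexI[of _ "_ + 2"])
  have inj: "inj_on (\<lambda>x. x - 2) {2..<2 * Suc n}"
    by (auto simp: inj_on_def)
  have \<tau>: "\<tau> permutes {..<2 * n}"
    unfolding \<tau>_def by (rule map_permutation_permutes[OF _ \<pi>']) (simp only: bij_betw_def inj img)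
  have "\<tau> ((x + 2) - 2) = \<pi> (x + 2) - 2" if "x < 2 * n" for x
    unfolding \<tau>_def by (rule map_permutation_apply[OF inj]) (use that in auto)
  moreover have "\<pi> (x + 2) \<ge> 2" if "x < 2 * n" for x
    using that permutes_in_image[OF \<pi>', of "x + 2"] by simp
  ultimately have \<tau>_eq: "\<tau> x + 2 = \<pi> (x + 2)" if "x < 2 * n" for x
    using that by fastforce
  have \<sigma>_\<tau>: "\<sigma> (x + 2) = skip_cycle (Suc k) (\<tau> x + 2)" if "x < 2 * n" for x
    using \<tau>_eq[OF that] \<sigma>_\<pi> by simp
  note ins = insert_pair[OF \<tau> \<open>k < 2 * n + 1\<close>]
  have "\<sigma> x = insert_pair n k \<tau> x" for x
  proof (cases "x < 2 * Suc n")
    case True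
    then consider "x = 0" | "x = 1" | y where "x = y + 2" "y < 2 * n"
      by (cases x rule: nat.exhaust; cases "x - 1") auto
    then show ?thesis
      using ins \<sigma>0 k \<sigma>_\<tau> by cases simp_all
  next
    case False
    then show ?thesis
      using \<sigma> ins(1) by (simp add: permutes_def)
  qed
  moreover have "\<tau> \<in> matchings n"
    unfolding matchings_def mem_Collect_eq
  proof (intro conjI allI impI \<tau>)
    have mono: "a < b" if "skip_cycle (Suc k) (a + 2) < skip_cycle (Suc k) (b + 2)" for a b
      using that by (auto simp: skip_cycle_def split: if_splits)
    show "\<tau> (2 * i) < \<tau> (2 * i + 1)" if "i < n" for i
      using pairs[of "Suc i"] \<sigma>_\<tau>[of "2 * i"] \<sigma>_\<tau>[of "2 * i + 1"] that by - (rule mono, simp)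
    show "\<tau> (2 * i) < \<tau> (2 * j)" if "i < j \<and> j < n" for i j
      using heads[of "Suc i" "Suc j"] \<sigma>_\<tau>[of "2 * i"] \<sigma>_\<tau>[of "2 * j"] that by - (rule mono, simp)
  qed
  ultimately show ?thesis
    using that[OF \<open>k < 2 * n + 1\<close>] by (simp add: fun_eq_iff)
qed

lemma insert_pair_inj:
  assumes "\<tau> permutes {..<2 * n}" "k < 2 * n + 1" "\<tau>' permutes {..<2 * n}" "k' < 2 * n + 1"
    and eq: "insert_pair n k \<tau> = insert_pair n k' \<tau>'"
  shows "k = k' \<and> \<tau> = \<tau>'"
proof
  note ins = insert_pair[OF assms(1,2)] and ins' = insert_pair[OF assms(3,4)]
  show "k = k'" using ins(4) ins'(4) eq by simp
  have "inj (skip_cycle (Suc k))"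
    by (rule permutes_inj[OF skip_cycle_permutes[OF assms(2)]])
  then have "\<tau> x = \<tau>' x" if "x < 2 * n" for x
    using ins(5)[OF that] ins'(5)[OF that] eq \<open>k = k'\<close> by (metis add_right_cancel injD)
  moreover have "\<tau> x = \<tau>' x" if "\<not> x < 2 * n" for x
    using assms(1,3) that by (simp add: permutes_def)
  ultimately show "\<tau> = \<tau>'" by blast
qed

theorem Pf_Suc:
  "Pf (Suc n) A = (\<Sum>k<2 * n + 1. (- 1) ^ k * A 0 (Suc k) *
     Pf n (\<lambda>a b. A (skip_cycle (Suc k) (a + 2)) (skip_cycle (Suc k) (b + 2))))"
proof -
  let ?ins = "\<lambda>(k, \<tau>). insert_pair n k \<tau>" and ?P = "{..<2 * n + 1} \<times> matchings n"
  have bij: "bij_betw ?ins ?P (matchings (Suc n))"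
  proof (rule bij_betw_imageI)
    show "inj_on ?ins ?P"
    proof (rule inj_onI)
      fix u v assume "u \<in> ?P" "v \<in> ?P" "?ins u = ?ins v"
      then show "u = v"
        using insert_pair_inj[of "snd u" n "fst u" "snd v" "fst v"]
        by (auto simp: matchings_def prod_eq_iff case_prod_beta)
    qed
    show "?ins ` ?P = matchings (Suc n)"
    proof
      show "?ins ` ?P \<subseteq> matchings (Suc n)"
        using insert_pair_matching by auto
      show "matchings (Suc n) \<subseteq> ?ins ` ?P"
      proof
        fix \<sigma> assume "\<sigma> \<in> matchings (Suc n)"
        then obtain k \<tau> where "k < 2 * n + 1" "\<tau> \<in> matchings n" "\<sigma> = insert_pair n k \<tau>"
          by (rule matchings_surj)
        then show "\<sigma> \<in> ?ins ` ?P"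
          by (intro image_eqI[of _ _ "(k, \<tau>)"]) simp_all
      qed
    qed
  qed
  have summand: "of_int (sign (insert_pair n k \<tau>)) *
      (\<Prod>i<Suc n. A (insert_pair n k \<tau> (2 * i)) (insert_pair n k \<tau> (2 * i + 1))) =
      (- 1) ^ k * A 0 (Suc k) * (of_int (sign \<tau>) * (\<Prod>i<n.
      A (skip_cycle (Suc k) (\<tau> (2 * i) + 2)) (skip_cycle (Suc k) (\<tau> (2 * i + 1) + 2))))"
    if "k < 2 * n + 1" "\<tau> \<in> matchings n" for k \<tau>
  proof -
    from that(2) have \<tau>: "\<tau> permutes {..<2 * n}" by (simp add: matchings_def)
    note ins = insert_pair[OF \<tau> that(1)]
    have "A (insert_pair n k \<tau> (2 * Suc i)) (insert_pair n k \<tau> (2 * Suc i + 1)) =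
      A (skip_cycle (Suc k) (\<tau> (2 * i) + 2)) (skip_cycle (Suc k) (\<tau> (2 * i + 1) + 2))"
      if "i < n" for i
      using ins(5)[of "2 * i"] ins(5)[of "2 * i + 1"] that by simp
    then have "(\<Prod>i<Suc n. A (insert_pair n k \<tau> (2 * i)) (insert_pair n k \<tau> (2 * i + 1))) =
      A 0 (Suc k) * (\<Prod>i<n. A (skip_cycle (Suc k) (\<tau> (2 * i) + 2))
        (skip_cycle (Suc k) (\<tau> (2 * i + 1) + 2)))"
      using ins(3,4) by (simp add: prod.lessThan_Suc_shift del: prod.lessThan_Suc mult_Suc_right)
    then show ?thesis
      by (simp add: ins(2) mult_ac)
  qed
  have "Pf (Suc n) A = (\<Sum>(k, \<tau>)\<in>?P. of_int (sign (insert_pair n k \<tau>)) *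
      (\<Prod>i<Suc n. A (insert_pair n k \<tau> (2 * i)) (insert_pair n k \<tau> (2 * i + 1))))"
    unfolding Pf_matchings sum.reindex_bij_betw[OF bij, symmetric] by (simp add: case_prod_beta)
  also have "\<dots> = (\<Sum>(k, \<tau>)\<in>?P. (- 1) ^ k * A 0 (Suc k) * (of_int (sign \<tau>) * (\<Prod>i<n.
      A (skip_cycle (Suc k) (\<tau> (2 * i) + 2)) (skip_cycle (Suc k) (\<tau> (2 * i + 1) + 2)))))"
    by (rule sum.cong[OF refl]) (simp only: case_prod_beta mem_Times_iff lessThan_iff summand)
  also have "\<dots> = (\<Sum>k<2 * n + 1. (- 1) ^ k * A 0 (Suc k) *
     Pf n (\<lambda>a b. A (skip_cycle (Suc k) (a + 2)) (skip_cycle (Suc k) (b + 2))))"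
    by (simp add: Pf_matchings sum.cartesian_product[symmetric] sum_distrib_left)
  finally show ?thesis .
qed

lemma Pf_0: "Pf 0 A = 1"
proof -
  have "matchings 0 = {id}" by (auto simp: matchings_def)
  then show ?thesis by (simp add: Pf_matchings sign_id)
qed

text \<open>The Pfaffian depends only on the entries above the diagonal.\<close>

lemma Pf_cong:
  assumes "\<And>i j. i < j \<Longrightarrow> j < 2 * n \<Longrightarrow> A i j = B i j"
  shows "Pf n A = Pf n B"
  unfolding Pf_matchings
proof (intro sum.cong refl arg_cong2[of _ _ _ _ "(*)"] prod.cong)
  fix \<sigma> i assume \<sigma>: "\<sigma> \<in> matchings n" and i: "i \<in> {..<n}"
  then have "\<sigma> (2 * i) < \<sigma> (2 * i + 1)" "\<sigma> permutes {..<2 * n}"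
    by (auto simp: matchings_def)
  then show "A (\<sigma> (2 * i)) (\<sigma> (2 * i + 1)) = B (\<sigma> (2 * i)) (\<sigma> (2 * i + 1))"
    using i permutes_in_image[of \<sigma> "{..<2 * n}" "2 * i + 1"] by (intro assms) auto
qed

text \<open>
  A function on lists that satisfies the first-row recursion for the pairing \<open>M\<close> is given by
  Pfaffians of \<open>M\<close>.
\<close>

lemma Pf_unique:
  fixes f :: "'b list \<Rightarrow> 'a::comm_ring_1"
  assumes Nil: "f [] = 1"
    and Cons: "\<And>x xs. odd (length xs) \<Longrightarrow> f (x # xs) =
      (\<Sum>k<length xs. (- 1) ^ k * (M x (xs ! k) * f (take k xs @ drop (Suc k) xs)))"
  shows "length xs = 2 * n \<Longrightarrow> Pf n (\<lambda>i j. M (xs ! i) (xs ! j)) = f xs"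
proof (induction n arbitrary: xs)
  case 0
  then show ?case by (simp add: Nil Pf_0)
next
  case (Suc n)
  then obtain x ys where xs: "xs = x # ys" and len: "length ys = 2 * n + 1"
    by (cases xs) auto
  have "Pf n (\<lambda>a b. M (xs ! skip_cycle (Suc k) (a + 2)) (xs ! skip_cycle (Suc k) (b + 2))) =
      f (take k ys @ drop (Suc k) ys)" if "k < 2 * n + 1" for k
  proof -
    let ?zs = "take k ys @ drop (Suc k) ys"
    have "xs ! skip_cycle (Suc k) (a + 2) = ?zs ! a" if "a < 2 * n" for a
      using that \<open>k < 2 * n + 1\<close> len by (auto simp: xs skip_cycle_def nth_append nth_Cons')
    then have "Pf n (\<lambda>a b. M (xs ! skip_cycle (Suc k) (a + 2)) (xs ! skip_cycle (Suc k) (b + 2))) =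
        Pf n (\<lambda>a b. M (?zs ! a) (?zs ! b))"
      by (intro Pf_cong) simp
    also have "\<dots> = f ?zs"
      using len that by (intro Suc.IH) simp
    finally show ?thesis .
  qed
  then show ?case
    unfolding Pf_Suc by (simp add: xs Cons len mult.assoc)
qed


section \<open>Exponentials over a noncommutative algebra\<close>
lemma alg_exp_nth:
  "alg_exp s A $ n = (\<Sum>k=0..n. s (1 / of_nat (fact k)) * (A ^ k) $ n)"
  by (simp add: alg_exp_def fps_compose_nth)

text \<open>
  If \<open>R\<close> commutes with scalars and intertwines the coefficients of two series, it intertwines
  those of their exponentials. With \<open>A = B\<close> this says that what commutes with a series commutes with its
  exponential.
\<close>

lemma alg_exp_intertwine:
  assumes "\<And>n. R * A $ n = B $ n * R" and "\<And>c. R * s c = s c * R"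
  shows "R * alg_exp s A $ n = alg_exp s B $ n * R"
proof -
  have power: "R * (A ^ k) $ n = (B ^ k) $ n * R" for k n
  proof (induction k arbitrary: n)
    case (Suc k)
    have "R * (A $ i * (A ^ k) $ (n - i)) = B $ i * (B ^ k) $ (n - i) * R" for i
      by (metis Suc assms(1) mult.assoc)
    then show ?case
      by (simp add: fps_mult_nth sum_distrib_left sum_distrib_right)
  qed simp
  have "R * (s c * (A ^ k) $ n) = s c * (B ^ k) $ n * R" for c k
    by (metis power assms(2) mult.assoc)
  then show ?thesis
    by (simp add: alg_exp_nth sum_distrib_left sum_distrib_right)
qed

lemma fps_power_nth_less:
  assumes "A $ 0 = (0::'a::ring_1)" "n < k"
  shows "(A ^ k) $ n = 0"
  using assms(2)
proof (induction k arbitrary: n)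
  case (Suc k)
  have "A $ i * (A ^ k) $ (n - i) = 0" if "i \<in> {0..n}" for i
  proof (cases "i = 0")
    case False
    then have "n - i < k" using that Suc.prems by simp
    then show ?thesis using Suc.IH by simp
  qed (simp add: assms(1))
  then show ?case by (simp add: fps_mult_nth)
qed simp

lemma alg_exp_deriv:
  fixes A :: "'a::ring_1 fps" and s :: "'k::field_char_0 \<Rightarrow> 'a"
  assumes s: "\<And>a b. s (a * b) = s a * s b" "\<And>n. s (of_nat n) = of_nat n"
    "\<And>c x. s c * x = x * s c"
    and comm: "\<And>i j. A $ i * A $ j = A $ j * A $ i" and zero: "A $ 0 = 0"
  shows "fps_deriv (alg_exp s A) = fps_deriv A * alg_exp s A"
proof -
  have deriv_comm: "A * fps_deriv A = fps_deriv A * A"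
  proof (rule fps_ext)
    fix n
    have "(A * fps_deriv A) $ n = (\<Sum>i=0..n. fps_deriv A $ (n - i) * A $ i)"
      unfolding fps_mult_nth
      by (intro sum.cong refl) (metis (no_types, lifting) comm fps_deriv_nth mult.assoc mult_of_nat_commute)
    also have "\<dots> = (\<Sum>i=0..n. fps_deriv A $ i * A $ (n - i))"
      by (rule sum.reindex_bij_witness[of _ "\<lambda>i. n - i" "\<lambda>i. n - i"]) auto
    finally show "(A * fps_deriv A) $ n = (fps_deriv A * A) $ n"
      by (simp only: fps_mult_nth)
  qed
  have deriv_power: "fps_deriv (A ^ Suc k) = of_nat (Suc k) * (fps_deriv A * A ^ k)" for k
  proof (induction k)
    case (Suc k)
    have "fps_deriv (A ^ Suc (Suc k)) = A * fps_deriv (A ^ Suc k) + fps_deriv A * A ^ Suc k"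
      by (subst power_Suc) simp
    also have "A * fps_deriv (A ^ Suc k) = of_nat (Suc k) * (fps_deriv A * A ^ Suc k)"
    proof -
      have "A * (of_nat (Suc k) * x) = of_nat (Suc k) * (A * x)" for x
        using mult_of_nat_commute[of "Suc k" A] by (simp only: mult.assoc[symmetric])
      moreover have "A * (fps_deriv A * x) = fps_deriv A * (A * x)" for x
        by (simp only: mult.assoc[symmetric] deriv_comm)
      ultimately show ?thesis
        unfolding Suc.IH by (simp only: power_Suc)
    qed
    finally show ?case
      by (simp add: algebra_simps)
  qed simp
  show ?thesis
  proof (rule fps_ext)
    fix n
    have coeff: "s (1 / of_nat (fact (Suc k))) * of_nat (Suc k) = s (1 / of_nat (fact k))" for k
    proof -
      have "s (1 / of_nat (fact (Suc k))) * of_nat (Suc k) =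
          s (1 / of_nat (fact (Suc k)) * of_nat (Suc k))"
        by (simp only: s(1,2))
      also have "1 / of_nat (fact (Suc k)) * of_nat (Suc k) = (1 / of_nat (fact k) :: 'k)"
      proof -
        have "(of_nat (fact (Suc k)) :: 'k) = of_nat (Suc k) * of_nat (fact k)"
          by (metis fact_Suc of_nat_id of_nat_mult)
        moreover have "of_nat (Suc k) \<noteq> (0 :: 'k)" by (rule of_nat_neq_0)
        moreover have "1 / (a * b) * a = 1 / b" if "a \<noteq> 0" for a b :: 'k
          using that by simp
        ultimately show ?thesis by metis
      qed
      finally show ?thesis .
    qed
    have s_left_commute: "s c * (x * y) = x * (s c * y)" for c x y
      by (metis s(3) mult.assoc)
    have "fps_deriv (alg_exp s A) $ n =
        (\<Sum>k=0..Suc n. s (1 / of_nat (fact k)) * fps_deriv (A ^ k) $ n)"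
      by (simp only: fps_deriv_nth alg_exp_nth sum_distrib_left Suc_eq_plus1[symmetric] s_left_commute)
    also have "\<dots> = (\<Sum>k=0..n. s (1 / of_nat (fact (Suc k))) * fps_deriv (A ^ Suc k) $ n)"
      by (subst sum.atLeast0_atMost_Suc_shift) (simp add: comp_def del: power_Suc fact_Suc fps_deriv_nth)
    also have "\<dots> = (\<Sum>k=0..n. s (1 / of_nat (fact k)) * (fps_deriv A * A ^ k) $ n)"
    proof (rule sum.cong[OF refl])
      fix k
      have "fps_deriv (A ^ Suc k) $ n = of_nat (Suc k) * (fps_deriv A * A ^ k) $ n"
        unfolding deriv_power fps_of_nat[symmetric] by (rule fps_mult_left_const_nth)
      then show "s (1 / of_nat (fact (Suc k))) * fps_deriv (A ^ Suc k) $ n =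
          s (1 / of_nat (fact k)) * (fps_deriv A * A ^ k) $ n"
        by (simp only: mult.assoc[symmetric] coeff)
    qed
    also have "\<dots> = (\<Sum>i=0..n. \<Sum>k=0..n. fps_deriv A $ i * (s (1 / of_nat (fact k)) * (A ^ k) $ (n - i)))"
      by (subst sum.swap) (simp only: fps_mult_nth sum_distrib_left s_left_commute)
    also have "\<dots> = (\<Sum>i=0..n. \<Sum>k=0..n - i. fps_deriv A $ i * (s (1 / of_nat (fact k)) * (A ^ k) $ (n - i)))"
      by (intro sum.cong refl sum.mono_neutral_right) (auto simp: fps_power_nth_less[OF zero])
    also have "\<dots> = (fps_deriv A * alg_exp s A) $ n"
      by (simp only: fps_mult_nth alg_exp_nth sum_distrib_left)
    finally show "fps_deriv (alg_exp s A) $ n = (fps_deriv A * alg_exp s A) $ n" .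
  qed
qed

text \<open>The indices of the terms that an odd series contributes up to degree \<open>n\<close>.\<close>

definition odds :: "nat \<Rightarrow> nat set" where
  "odds n = {m. odd m \<and> m \<le> n}"

lemma finite_odds [simp]: "finite (odds n)"
  by (simp add: odds_def)

text \<open>
  The equation $z E' = z B' E$ for $E = \exp B$, in coefficients. It needs the coefficients of $B$
  to commute with each other, so that $(B^k)' = k B' B^{k-1}$.
\<close>

lemma alg_exp_odd_series:
  fixes b :: "nat \<Rightarrow> 'a::ring_1" and s :: "'k::field_char_0 \<Rightarrow> 'a"
  assumes s: "\<And>a b. s (a * b) = s a * s b" "\<And>n. s (of_nat n) = of_nat n"
    "\<And>c x. s c * x = x * s c"
    and comm: "\<And>i j. b i * b j = b j * b i"
  shows "alg_exp s (odd_series b) $ 0 = 1"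
    and "of_nat n * alg_exp s (odd_series b) $ n =
      (\<Sum>m\<in>odds n. of_nat m * (b m * alg_exp s (odd_series b) $ (n - m)))"
proof -
  let ?E = "alg_exp s (odd_series b)"
  show "?E $ 0 = 1"
    using s(2)[of 1] by (simp add: alg_exp_nth)
  show "of_nat n * ?E $ n = (\<Sum>m\<in>odds n. of_nat m * (b m * ?E $ (n - m)))"
  proof (cases n)
    case 0
    then show ?thesis by (auto simp: odds_def)
  next
    case (Suc l)
    have "of_nat (Suc l) * ?E $ Suc l = fps_deriv ?E $ l"
      by simp
    also have "\<dots> = (fps_deriv (odd_series b) * ?E) $ l"
      using comm by (subst alg_exp_deriv[OF s]) (auto simp: odd_series_def)
    also have "\<dots> = (\<Sum>i=0..l. of_nat (Suc i) * (odd_series b $ Suc i * ?E $ (l - i)))"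
      by (simp add: fps_mult_nth mult.assoc del: of_nat_Suc)
    also have "\<dots> = (\<Sum>m=1..Suc l. of_nat m * (odd_series b $ m * ?E $ (Suc l - m)))"
      by (rule sum.reindex_bij_witness[of _ "\<lambda>m. m - 1" Suc]) auto
    also have "\<dots> = (\<Sum>m\<in>odds (Suc l). of_nat m * (odd_series b $ m * ?E $ (Suc l - m)))"
      by (rule sum.mono_neutral_right) (auto simp: odds_def odd_series_def Suc_le_eq odd_pos)
    finally show ?thesis
      by (simp add: Suc odds_def odd_series_def)
  qed
qed

lemma double_odd_series: "2 * odd_series b = odd_series (\<lambda>n. 2 * b n)"
  by (simp add: odd_series_def fps_eq_iff mult_2)


section \<open>Linear operators and partial derivatives\<close>

lemma const_poly_add: "const_poly (a + b) = const_poly a + const_poly b"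
  by (simp add: const_poly_def single_add)

lemma const_poly_mult: "const_poly (a * b) = const_poly a * const_poly b"
  by (simp add: const_poly_def mult_single)

lemma const_poly_1 [simp]: "const_poly 1 = 1"
  by (simp add: const_poly_def)

lemma const_poly_of_nat: "const_poly (of_nat n) = of_nat n"
  by (induction n) (simp_all add: const_poly_add, simp add: const_poly_def)

lemma lin_op_eqI: "(\<And>f. app A f = app B f) \<Longrightarrow> A = B"
  by (metis app_inject ext)

lemma app_scale: "app A (const_poly c * f) = const_poly c * app A f"
  using app[of A] by (simp add: is_linear_def)

lemma app_of_nat [simp]: "app (of_nat n) f = of_nat n * f"
  by (induction n) (simp_all add: algebra_simps)

lemma scalar_op_mult: "scalar_op (a * b) = scalar_op a * scalar_op b"
  by (rule lin_op_eqI) (simp add: const_poly_mult mult.assoc)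

lemma scalar_op_of_nat: "scalar_op (of_nat n) = of_nat n"
  by (rule lin_op_eqI) (simp add: const_poly_of_nat)

lemma scalar_op_central: "scalar_op c * A = A * scalar_op c"
  by (rule lin_op_eqI) (simp add: app_scale)

lemmas scalar_op_hom = scalar_op_mult scalar_op_of_nat scalar_op_central

lemma lookup_partial:
  fixes f :: "'k::comm_ring_1 odd_poly"
  shows "Poly_Mapping.lookup (partial n f) m = of_nat (Suc (Poly_Mapping.lookup m (n div 2))) *
    Poly_Mapping.lookup f (m + Poly_Mapping.single (n div 2) 1)"
proof -
  let ?e = "Poly_Mapping.single (n div 2) (1::nat)"
  have iff: "m' - ?e = m \<longleftrightarrow> m' = m + ?e" if "Poly_Mapping.lookup m' (n div 2) \<noteq> 0" for m'
  proof
    assume "m' - ?e = m"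
    then show "m' = m + ?e"
      using that by (intro poly_mapping_eqI) (auto simp: lookup_add lookup_minus lookup_single when_def)
  qed simp
  have "Poly_Mapping.lookup (Poly_Mapping.single (m' - ?e)
      (of_nat (Poly_Mapping.lookup m' (n div 2)) * Poly_Mapping.lookup f m')) m =
    (if m' = m + ?e then of_nat (Suc (Poly_Mapping.lookup m (n div 2))) * Poly_Mapping.lookup f m' else 0)"
    for m'
    using iff[of m'] by (cases "Poly_Mapping.lookup m' (n div 2) = 0")
      (auto simp: lookup_single when_def lookup_add)
  then show ?thesis
    by (simp add: partial_def lookup_sum in_keys_iff del: of_nat_Suc)
qed

lemma partial_add: "partial n (f + g) = partial n f + partial n (g :: 'k::comm_ring_1 odd_poly)"
  by (rule poly_mapping_eqI) (simp only: lookup_partial lookup_add distrib_left)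

lemma partial_zero [simp]: "partial n 0 = (0 :: 'k::comm_ring_1 odd_poly)"
  by (simp add: partial_def)

lemma partial_sum: "partial n (sum f S) = (\<Sum>x\<in>S. partial n (f x :: 'k::comm_ring_1 odd_poly))"
  by (induction S rule: infinite_finite_induct) (simp_all add: partial_add)

lemma partial_commute: "partial n (partial m f) = partial m (partial n (f :: 'k::comm_ring_1 odd_poly))"
proof (rule poly_mapping_eqI)
  fix x
  show "Poly_Mapping.lookup (partial n (partial m f)) x = Poly_Mapping.lookup (partial m (partial n f)) x"
    by (cases "n div 2 = m div 2")
      (simp_all add: lookup_partial lookup_add lookup_single add_ac mult_ac del: of_nat_Suc)
qed

lemma partial_single:
  "partial n (Poly_Mapping.single m c) = Poly_Mapping.single (m - Poly_Mapping.single (n div 2) 1)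
    (of_nat (Poly_Mapping.lookup m (n div 2)) * (c :: 'k::comm_ring_1))"
  by (subst partial_superset[of "{m}"]) simp_all

lemma partial_mult_single:
  fixes c d :: "'k::comm_ring_1"
  shows "partial n (Poly_Mapping.single a c * Poly_Mapping.single b d) =
    partial n (Poly_Mapping.single a c) * Poly_Mapping.single b d +
    Poly_Mapping.single a c * partial n (Poly_Mapping.single b d)"
proof -
  let ?e = "Poly_Mapping.single (n div 2) (1::nat)" and ?l = "\<lambda>m. Poly_Mapping.lookup m (n div 2)"
  have sub: "a - ?e + b = a + b - ?e" if "?l a \<noteq> 0" for a b
    using that by (intro poly_mapping_eqI) (auto simp: lookup_add lookup_minus lookup_single when_def)
  have "Poly_Mapping.single (a - ?e + b) (of_nat (?l a) * c * d) =
      Poly_Mapping.single (a + b - ?e) (of_nat (?l a) * c * d)"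
  proof (cases "?l a = 0")
    case False
    then show ?thesis by (simp only: sub[OF False])
  qed simp
  moreover have "Poly_Mapping.single (a + (b - ?e)) (c * (of_nat (?l b) * d)) =
      Poly_Mapping.single (a + b - ?e) (c * (of_nat (?l b) * d))"
  proof (cases "?l b = 0")
    case False
    then show ?thesis using sub[of b a] by (simp add: add.commute)
  qed simp
  ultimately show ?thesis
    by (simp add: partial_single mult_single lookup_add flip: single_add)
      (simp add: algebra_simps)
qed

lemma sum_single_lookup:
  "(\<Sum>m\<in>Poly_Mapping.keys f. Poly_Mapping.single m (Poly_Mapping.lookup f m)) =
   (f :: 'k::comm_ring_1 odd_poly)"
  by (intro poly_mapping_eqI) (simp add: lookup_sum lookup_single when_def in_keys_iff)

lemma odd_poly_sum_singles:
  obtains S and h :: "(nat \<Rightarrow>\<^sub>0 nat) \<Rightarrow> 'k::comm_ring_1" where "f = (\<Sum>m\<in>S. Poly_Mapping.single m (h m))"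
  using sum_single_lookup[of f] by metis

lemma partial_mult:
  fixes f g :: "'k::comm_ring_1 odd_poly"
  shows "partial n (f * g) = partial n f * g + f * partial n g"
proof -
  obtain S h where f: "f = (\<Sum>m\<in>S. Poly_Mapping.single m (h m))"
    by (rule odd_poly_sum_singles)
  obtain T k where g: "g = (\<Sum>m\<in>T. Poly_Mapping.single m (k m))"
    by (rule odd_poly_sum_singles)
  show ?thesis
    unfolding f g by (simp add: sum_product partial_sum partial_mult_single sum.distrib)
qed

lemma partial_one [simp]: "partial n 1 = (0 :: 'k::comm_ring_1 odd_poly)"
  using partial_mult[of n 1 "1 :: 'k odd_poly"] by simp

lemma partial_of_nat_mult: "partial n (of_nat k * f) = of_nat k * partial n (f :: 'k::comm_ring_1 odd_poly)"
  by (induction k) (simp_all add: distrib_right partial_add)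

lemma partial_diff: "partial n (f - g) = partial n f - partial n (g :: 'k::comm_ring_1 odd_poly)"
  using partial_add[of n "f - g" g] by (simp add: eq_diff_eq)

lemma partial_of_int_mult: "partial n (of_int k * f) = of_int k * partial n (f :: 'k::comm_ring_1 odd_poly)"
  by (cases k rule: int_diff_cases) (simp add: partial_of_nat_mult partial_diff left_diff_distrib)

lemma partial_psum:
  assumes "odd n" "odd m"
  shows "partial n (psum m) = (if n = m then 1 else 0 :: 'k::comm_ring_1 odd_poly)"
proof -
  have "n div 2 = m div 2 \<longleftrightarrow> n = m"
    using assms by (auto elim!: oddE)
  then show ?thesis
    by (auto simp: psum_def partial_single lookup_single)
qed


section \<open>Extension of scalars\<close>

lemma rat_const_add: "rat_const (a + b) = rat_const a + rat_const b"
  by (simp add: rat_const_def flip: to_fract_add)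

lemma rat_const_mult: "rat_const (a * b) = rat_const a * rat_const b"
  by (simp add: rat_const_def flip: to_fract_mult)

lemma rat_const_0 [simp]: "rat_const 0 = 0"
  by (simp add: rat_const_def)

lemma rat_const_1 [simp]: "rat_const 1 = 1"
  by (simp add: rat_const_def flip: one_pCons)

lemma rat_const_eq_0_iff [simp]: "rat_const c = 0 \<longleftrightarrow> c = 0"
  by (simp add: rat_const_def)

lemma lookup_extend_scalars: "Poly_Mapping.lookup (extend_scalars f) m = rat_const (Poly_Mapping.lookup f m)"
  by (simp add: extend_scalars_def map.rep_eq when_def)

lemma extend_scalars_single: "extend_scalars (Poly_Mapping.single m c) = Poly_Mapping.single m (rat_const c)"
  by (rule poly_mapping_eqI) (simp add: lookup_extend_scalars lookup_single when_def)

lemma extend_scalars_add: "extend_scalars (f + g) = extend_scalars f + extend_scalars g"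
  by (rule poly_mapping_eqI) (simp add: lookup_extend_scalars lookup_add rat_const_add)

lemma extend_scalars_0 [simp]: "extend_scalars 0 = 0"
  by (rule poly_mapping_eqI) (simp add: lookup_extend_scalars)

lemma extend_scalars_1 [simp]: "extend_scalars 1 = 1"
  using extend_scalars_single[of 0 1] by simp

lemma extend_scalars_diff: "extend_scalars (f - g) = extend_scalars f - extend_scalars g"
  using extend_scalars_add[of "f - g" g] by (simp add: eq_diff_eq)

lemma extend_scalars_sum: "extend_scalars (sum f S) = (\<Sum>x\<in>S. extend_scalars (f x))"
  by (induction S rule: infinite_finite_induct) (simp_all add: extend_scalars_add)

lemma extend_scalars_mult: "extend_scalars (f * g) = extend_scalars f * extend_scalars g"
proof -
  obtain S h where f: "f = (\<Sum>m\<in>S. Poly_Mapping.single m (h m))"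
    by (rule odd_poly_sum_singles)
  obtain T k where g: "g = (\<Sum>m\<in>T. Poly_Mapping.single m (k m))"
    by (rule odd_poly_sum_singles)
  show ?thesis
    unfolding f g by (simp add: sum_product extend_scalars_sum extend_scalars_single mult_single rat_const_mult)
qed

lemma extend_scalars_prod: "extend_scalars (prod f S) = (\<Prod>x\<in>S. extend_scalars (f x))"
  by (induction S rule: infinite_finite_induct) (simp_all add: extend_scalars_mult)

lemma extend_scalars_of_nat: "extend_scalars (of_nat n) = of_nat n"
  by (induction n) (simp_all add: extend_scalars_add)

lemma extend_scalars_of_int: "extend_scalars (of_int n) = of_int n"
  by (cases n rule: int_diff_cases) (simp add: extend_scalars_of_nat extend_scalars_diff)

lemma extend_scalars_psum: "extend_scalars (psum n) = psum n"
  by (simp add: psum_def extend_scalars_single)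

lemma extend_scalars_Pf: "extend_scalars (Pf n A) = Pf n (\<lambda>i j. extend_scalars (A i j))"
  by (simp add: Pf_def extend_scalars_sum extend_scalars_mult extend_scalars_of_int extend_scalars_prod)

lemma rho_t_extend_scalars: "rho_t (extend_scalars f) = pleth_X_minus_tX f"
proof -
  have "Poly_Mapping.keys (extend_scalars f) = Poly_Mapping.keys f"
    by (auto simp: in_keys_iff lookup_extend_scalars)
  then show ?thesis
    by (simp add: rho_t_def pleth_X_minus_tX_def eval_poly_def lookup_extend_scalars)
qed


section \<open>The neutral vertex operator\<close>

lemma odds_diff_less: "m \<in> odds n \<Longrightarrow> n - m < n"
  by (cases m) (auto simp: odds_def)

text \<open>The two exponential factors of $\Phi(z)$, as series in $z^{-1}$ and in \<open>z\<close>.\<close>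

definition annihilation_exp :: "lin_op fps" where
  "annihilation_exp = alg_exp scalar_op (- odd_series (\<lambda>n. scalar_op (2 / of_nat n) * annihilation n))"

definition creation_exp :: "lin_op fps" where
  "creation_exp = alg_exp scalar_op (odd_series (\<lambda>n. scalar_op (2 / of_nat n) * creation n))"

text \<open>The operators $D_i$ of the annihilation half.\<close>

definition skew :: "nat \<Rightarrow> gamma_t \<Rightarrow> gamma_t" where
  "skew i f = app (annihilation_exp $ i) f"

text \<open>
  The one-row functions over $\mathbb{Q}(t)$, with the convention that they vanish at negative
  indices.
\<close>

definition q_t :: "int \<Rightarrow> gamma_t" where
  "q_t r = (if r < 0 then 0 else extend_scalars (q_row (nat r)))"

lemma skew_add: "skew i (f + g) = skew i f + skew i g"
  by (simp add: skew_def app_add)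

lemma annihilation_op: "n > 0 \<Longrightarrow> scalar_op (2 / of_nat n) * annihilation n = partial_op n"
  by (rule lin_op_eqI) (simp add: mult.assoc[symmetric] flip: const_poly_mult)

lemma annihilation_exp_eq: "annihilation_exp = alg_exp scalar_op (odd_series (\<lambda>n. - partial_op n))"
proof -
  have "- odd_series (\<lambda>n. scalar_op (2 / of_nat n) * annihilation n) = odd_series (\<lambda>n. - partial_op n)"
    by (auto simp: odd_series_def fps_eq_iff annihilation_op odd_pos)
  then show ?thesis
    by (simp add: annihilation_exp_def)
qed

lemma partial_op_commute: "partial_op n * partial_op m = partial_op m * partial_op n"
  by (rule lin_op_eqI) (simp add: partial_commute)

lemma skew_0: "skew 0 f = f"
  unfolding skew_def annihilation_exp_eq
  by (subst alg_exp_odd_series(1)[OF scalar_op_hom]) (simp_all add: partial_op_commute)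

lemma skew_rec: "of_nat n * skew n f = - (\<Sum>m\<in>odds n. of_nat m * partial m (skew (n - m) f))"
proof -
  have "of_nat n * skew n f = app (of_nat n * annihilation_exp $ n) f"
    by (simp add: skew_def)
  also have "of_nat n * annihilation_exp $ n =
      (\<Sum>m\<in>odds n. of_nat m * (- partial_op m * annihilation_exp $ (n - m)))"
    unfolding annihilation_exp_eq
    by (rule alg_exp_odd_series(2)[OF scalar_op_hom]) (simp add: partial_op_commute)
  finally show ?thesis
    by (simp add: app_sum skew_def sum_negf)
qed

lemma partial_op_skew_commute: "partial_op n * annihilation_exp $ i = annihilation_exp $ i * partial_op n"
  unfolding annihilation_exp_eq
  by (rule alg_exp_intertwine) (auto simp: odd_series_def partial_op_commute scalar_op_central)

lemma partial_skew: "partial n (skew i f) = skew i (partial n f)"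
  using partial_op_skew_commute[of n i] by (metis app_partial_op app_times skew_def)

lemma skew_commute: "skew i (skew j f) = skew j (skew i f)"
proof -
  have "annihilation_exp $ i * annihilation_exp $ j = annihilation_exp $ j * annihilation_exp $ i"
  proof -
    have "annihilation_exp $ i * alg_exp scalar_op (odd_series (\<lambda>n. - partial_op n)) $ j =
        alg_exp scalar_op (odd_series (\<lambda>n. - partial_op n)) $ j * annihilation_exp $ i"
      by (rule alg_exp_intertwine)
        (auto simp: odd_series_def partial_op_skew_commute scalar_op_central)
    then show ?thesis by (simp only: annihilation_exp_eq)
  qed
  then show ?thesis by (metis app_times skew_def)
qed

lemma skew_finite: "finite {i. skew i f \<noteq> 0}"
  unfolding skew_def annihilation_exp_def by (rule finite_annihilation_exp)

lemma skew_one: "i > 0 \<Longrightarrow> skew i 1 = 0"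
proof -
  assume "i > 0"
  have "skew j 0 = 0" for j using skew_add[of j 0 0] by simp
  then have "of_nat i * skew i 1 = 0"
    by (simp add: skew_rec partial_skew)
  then show ?thesis using \<open>i > 0\<close> by simp
qed

lemma q_row_0: "q_row 0 = 1"
  unfolding q_row_def double_odd_series
  by (rule alg_exp_odd_series(1)) (simp_all add: const_poly_mult const_poly_of_nat mult_ac)

lemma q_row_rec: "of_nat n * q_row n = (\<Sum>m\<in>odds n. 2 * psum m * q_row (n - m))"
proof -
  have "of_nat n * q_row n = (\<Sum>m\<in>odds n. of_nat m *
      (2 * (const_poly (1 / of_nat m) * psum m) * q_row (n - m)))"
    unfolding q_row_def double_odd_series
    by (rule alg_exp_odd_series(2)) (simp_all add: const_poly_mult const_poly_of_nat mult_ac)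
  also have "\<dots> = (\<Sum>m\<in>odds n. 2 * psum m * q_row (n - m))"
  proof (rule sum.cong[OF refl])
    fix m assume "m \<in> odds n"
    then have "m > 0" by (auto simp: odds_def odd_pos)
    then have "of_nat m * const_poly (1 / of_nat m) = (1 :: gamma)"
      by (simp flip: const_poly_of_nat const_poly_mult)
    then show "of_nat m * (2 * (const_poly (1 / of_nat m) * psum m) * q_row (n - m)) =
        2 * psum m * q_row (n - m)"
      by (metis (no_types, opaque_lifting) mult.assoc mult.left_commute mult_1)
  qed
  finally show ?thesis .
qed

lemma q_t_0: "q_t 0 = 1"
  by (simp add: q_t_def q_row_0)

lemma q_t_neg: "r < 0 \<Longrightarrow> q_t r = 0"
  by (simp add: q_t_def)

lemma q_t_nonneg: "q_t r \<noteq> 0 \<Longrightarrow> 0 \<le> r"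
  by (simp add: q_t_def split: if_splits)

lemma q_t_int: "q_t (int n) = extend_scalars (q_row n)"
  by (simp add: q_t_def)

lemma q_t_rec_nat: "of_nat n * q_t (int n) = (\<Sum>m\<in>odds n. 2 * psum m * q_t (int (n - m)))"
proof -
  have "extend_scalars 2 = 2" using extend_scalars_of_nat[of 2] by simp
  then show ?thesis
    using arg_cong[OF q_row_rec[of n], of extend_scalars]
    by (simp add: extend_scalars_mult extend_scalars_of_nat extend_scalars_sum extend_scalars_psum
        q_t_int del: of_nat_diff)
qed

lemma q_t_rec:
  assumes "r \<le> int N"
  shows "of_int r * q_t r = (\<Sum>m\<in>odds N. 2 * psum m * q_t (r - int m))"
proof (cases "r < 0")
  case True
  then show ?thesis by (simp add: q_t_neg)
next
  case False
  then obtain n where n: "r = int n" "n \<le> N" using assms by (cases r) auto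
  have "(\<Sum>m\<in>odds N. 2 * psum m * q_t (r - int m)) = (\<Sum>m\<in>odds n. 2 * psum m * q_t (r - int m))"
    using n by (intro sum.mono_neutral_right) (auto simp: odds_def dest: q_t_nonneg)
  also have "\<dots> = (\<Sum>m\<in>odds n. 2 * psum m * q_t (int (n - m)))"
    using n by (intro sum.cong) (auto simp: odds_def of_nat_diff)
  finally show ?thesis using q_t_rec_nat[of n] n by simp
qed

lemma app_creation_exp: "app (creation_exp $ n) f = q_t (int n) * f"
proof (induction n rule: less_induct)
  case (less n)
  have comm: "(scalar_op (2 / of_nat i) * creation i) * (scalar_op (2 / of_nat j) * creation j) =
    (scalar_op (2 / of_nat j) * creation j) * (scalar_op (2 / of_nat i) * creation i)" for i j
    by (rule lin_op_eqI) (simp add: mult_ac)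
  note E = alg_exp_odd_series[OF scalar_op_hom, of "\<lambda>n. scalar_op (2 / of_nat n) * creation n",
      OF comm, folded creation_exp_def]
  show ?case
  proof (cases "n = 0")
    case True
    then show ?thesis by (simp add: E(1) q_t_0)
  next
    case False
    have "of_nat n * app (creation_exp $ n) f = app (of_nat n * creation_exp $ n) f"
      by simp
    also have "\<dots> = (\<Sum>m\<in>odds n. 2 * psum m * app (creation_exp $ (n - m)) f)"
      unfolding E(2) app_sum
    proof (rule sum.cong[OF refl])
      fix m assume "m \<in> odds n"
      then have "m > 0" by (auto simp: odds_def odd_pos)
      then have "of_nat m * const_poly (2 / of_nat m) = (const_poly 2 :: gamma_t)"
        by (simp flip: const_poly_of_nat const_poly_mult)
      also have "\<dots> = 2" using const_poly_of_nat[of 2] by simp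
      finally have c: "of_nat m * (const_poly (2 / of_nat m) * g) = 2 * g" for g :: gamma_t
        by (simp add: mult.assoc[symmetric])
      show "app (of_nat m * (scalar_op (2 / of_nat m) * creation m * creation_exp $ (n - m))) f =
        2 * psum m * app (creation_exp $ (n - m)) f"
        by (simp add: c mult.assoc)
    qed
    also have "\<dots> = (\<Sum>m\<in>odds n. 2 * psum m * (q_t (int (n - m)) * f))"
      by (rule sum.cong[OF refl]) (simp add: less.IH odds_diff_less del: of_nat_diff)
    also have "\<dots> = of_nat n * (q_t (int n) * f)"
      by (simp only: mult.assoc[symmetric] q_t_rec_nat sum_distrib_right)
    finally show ?thesis using False by simp
  qed
qed

text \<open>
  The derivative $\partial q_r / \partial p_n = (2/n) q_{r-n}$, by induction on \<open>r\<close> from the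
  recursion \<open>q_t_rec\<close>, so that no derivative of an exponential in infinitely many variables is
  needed.
\<close>

lemma partial_q_t:
  assumes "odd n"
  shows "of_nat n * partial n (q_t r) = 2 * q_t (r - int n)"
proof (cases "r < 0")
  case True
  then show ?thesis by (simp add: q_t_neg)
next
  case False
  then obtain k where "r = int k" by (cases r) auto
  moreover have "of_nat n * partial n (q_t (int k)) = 2 * q_t (int k - int n)"
  proof (induction k rule: less_induct)
    case (less k)
    show ?case
    proof (cases "k = 0")
      case True
      then show ?thesis using assms by (simp add: q_t_0 q_t_neg odd_pos)
    next
      case False
      have IH: "of_nat n * partial n (q_t (int k - int m)) = 2 * q_t (int k - int n - int m)"
        if "m \<in> odds k" for m
        using less.IH[OF odds_diff_less[OF that]] that by (auto simp: odds_def of_nat_diff algebra_simps)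
      have "of_nat k * (of_nat n * partial n (q_t (int k))) =
          of_nat n * partial n (of_int (int k) * q_t (int k))"
        by (simp add: partial_of_nat_mult mult.left_commute)
      also have "\<dots> = of_nat n * (\<Sum>m\<in>odds k. 2 * (partial n (psum m) * q_t (int k - int m) +
          psum m * partial n (q_t (int k - int m))))"
        using partial_of_nat_mult[of n 2 "1 :: gamma_t"]
        by (subst q_t_rec[of _ k]) (simp_all add: partial_sum partial_mult mult.assoc)
      also have "\<dots> = (\<Sum>m\<in>odds k. 2 * of_nat n * (if m = n then q_t (int k - int n) else 0)) +
          2 * (\<Sum>m\<in>odds k. 2 * psum m * q_t (int k - int n - int m))"
        unfolding sum_distrib_left sum.distrib[symmetric]
      proof (rule sum.cong[OF refl])
        fix m assume m: "m \<in> odds k"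
        have "partial n (psum m) = (if m = n then 1 else 0 :: gamma_t)"
          using partial_psum[of n m] assms m by (auto simp: odds_def)
        moreover have "of_nat n * (2 * (x + psum m * partial n (q_t (int k - int m)))) =
            2 * of_nat n * x + 2 * (2 * psum m * q_t (int k - int n - int m))" for x
          using IH[OF m] by (simp add: algebra_simps)
        ultimately show "of_nat n * (2 * (partial n (psum m) * q_t (int k - int m) +
            psum m * partial n (q_t (int k - int m)))) =
          2 * of_nat n * (if m = n then q_t (int k - int n) else 0) +
          2 * (2 * psum m * q_t (int k - int n - int m))"
          by auto
      qed
      also have "(\<Sum>m\<in>odds k. 2 * of_nat n * (if m = n then q_t (int k - int n) else 0)) =
          2 * of_nat n * q_t (int k - int n)"
        using assms by (auto simp: odds_def q_t_neg sum_distrib_left[symmetric])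
      also have "(\<Sum>m\<in>odds k. 2 * psum m * q_t (int k - int n - int m)) =
          of_int (int k - int n) * q_t (int k - int n)"
        by (rule q_t_rec[symmetric]) simp
      also have "2 * of_nat n * q_t (int k - int n) + 2 * (of_int (int k - int n) * q_t (int k - int n)) =
          of_nat k * (2 * q_t (int k - int n))"
        by (simp add: algebra_simps)
      finally show ?thesis using False by simp
    qed
  qed
  ultimately show ?thesis by simp
qed

text \<open>
  The differential equation $x Y' = - \sum_n n x^n \partial Y / \partial p_n$ (\<open>n\<close> odd), in
  coefficients. Its right side is a derivation, so its solutions are closed under products; they
  are determined by the constant term.
\<close>

definition skew_flow :: "gamma_t fps \<Rightarrow> bool" where
  "skew_flow Y \<longleftrightarrow> (\<forall>n. of_nat n * Y $ n = - (\<Sum>m\<in>odds n. of_nat m * partial m (Y $ (n - m))))"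

lemma skew_flow_unique:
  assumes "skew_flow Y" "skew_flow Z" "Y $ 0 = Z $ 0"
  shows "Y = Z"
proof (rule fps_ext)
  fix n show "Y $ n = Z $ n"
  proof (induction n rule: less_induct)
    case (less n)
    show ?case
    proof (cases "n = 0")
      case False
      have "(\<Sum>m\<in>odds n. of_nat m * partial m (Y $ (n - m))) =
          (\<Sum>m\<in>odds n. of_nat m * partial m (Z $ (n - m)))"
        by (rule sum.cong[OF refl]) (simp add: less.IH odds_diff_less)
      then have "of_nat n * Y $ n = of_nat n * Z $ n"
        using assms(1,2) by (simp add: skew_flow_def)
      then show ?thesis using False by simp
    qed (simp add: assms(3))
  qed
qed

lemma skew_flow_mult:
  assumes "skew_flow U" "skew_flow V"
  shows "skew_flow (U * V)"
proof -
  define P where "P m Y = Abs_fps (\<lambda>n. partial m (Y $ n))" for m and Y :: "gamma_t fps"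
  \<comment> \<open>The right side of the equation, cut off at \<open>n = N\<close> so that it is a finite sum; this does
    not affect the coefficients up to \<open>N\<close>.\<close>
  define L where "L N Y = (\<Sum>m\<in>odds N. of_nat m * (fps_X ^ m * P m Y))" for N and Y :: "gamma_t fps"
  have P_mult: "P m (U * V) = P m U * V + U * P m V" for m
    by (rule fps_ext) (simp add: P_def fps_mult_nth partial_sum partial_mult sum.distrib)
  have L_mult: "L N (U * V) = L N U * V + U * L N V" for N
    by (simp add: L_def P_mult sum_distrib_left sum_distrib_right sum.distrib algebra_simps)
  have L_nth: "L N Y $ n = (\<Sum>m\<in>odds n. of_nat m * partial m (Y $ (n - m)))" if "n \<le> N" for n N Y
  proof -
    have "L N Y $ n = (\<Sum>m\<in>odds N. of_nat m * (if n < m then 0 else partial m (Y $ (n - m))))"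
      by (simp add: L_def fps_sum_nth fps_X_power_mult_nth flip: fps_of_nat)
        (auto simp: P_def intro!: sum.cong)
    also have "\<dots> = (\<Sum>m\<in>odds n. of_nat m * (if n < m then 0 else partial m (Y $ (n - m))))"
      using that by (intro sum.mono_neutral_right) (auto simp: odds_def)
    finally show ?thesis by (simp add: odds_def)
  qed
  have euler_nth: "(fps_X * fps_deriv Y) $ n = of_nat n * Y $ n" for n and Y :: "gamma_t fps"
    by (cases n) simp_all
  have flow: "(fps_X * fps_deriv Y) $ n = - L N Y $ n" if "skew_flow Y" "n \<le> N" for Y n N
    using that(1) by (simp only: euler_nth skew_flow_def L_nth[OF that(2)] fps_neg_nth)
  have "of_nat n * (U * V) $ n = - L n (U * V) $ n" for n
  proof -
    have "of_nat n * (U * V) $ n = (fps_X * fps_deriv (U * V)) $ n"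
      by (rule euler_nth[symmetric])
    also have "fps_X * fps_deriv (U * V) = (fps_X * fps_deriv U) * V + U * (fps_X * fps_deriv V)"
      by (simp add: algebra_simps)
    also have "\<dots> $ n = (- L n U * V + U * - L n V) $ n"
    proof -
      have "(fps_X * fps_deriv U * V) $ n = (- L n U * V) $ n"
        unfolding fps_mult_nth[of _ V]
        by (rule sum.cong[OF refl]) (simp only: flow[OF assms(1), of _ n] atLeastAtMost_iff)
      moreover have "(U * (fps_X * fps_deriv V)) $ n = (U * - L n V) $ n"
        unfolding fps_mult_nth[of U]
        by (rule sum.cong[OF refl]) (simp only: flow[OF assms(2), of _ n] diff_le_self)
      ultimately show ?thesis by (simp only: fps_add_nth)
    qed
    finally show ?thesis by (simp add: L_mult)
  qed
  then show ?thesis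
    by (simp add: skew_flow_def L_nth)
qed

lemma skew_flow_skew: "skew_flow (Abs_fps (\<lambda>i. skew i f))"
  by (simp add: skew_flow_def skew_rec)

text \<open>The coefficient of $u^k$ in $(1 - u)/(1 + u)$.\<close>

definition ratio_coeff :: "nat \<Rightarrow> int" where
  "ratio_coeff k = (if k = 0 then 1 else 2 * (- 1) ^ k)"

text \<open>
  Multiplied by $-2$, this is the coefficient form of
  $u g' = - 2 (u + u^3 + u^5 + \cdots) g$ for $g = (1 - u)/(1 + u)$.
\<close>

lemma sum_ratio_coeff: "(\<Sum>m\<in>odds n. ratio_coeff (n - m)) = - (int n * (- 1) ^ n)"
proof (induction n rule: nat_induct2)
  case 0
  show ?case by (auto simp: odds_def intro!: sum.neutral)
next
  case 1
  have "odds 1 = {1}" by (auto simp: odds_def elim: oddE)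
  then show ?case by (simp add: ratio_coeff_def)
next
  case (step n)
  have "odds (n + 2) = insert 1 ((\<lambda>m. m + 2) ` odds n)"
  proof (intro set_eqI iffI)
    fix m assume m: "m \<in> odds (n + 2)"
    show "m \<in> insert 1 ((\<lambda>m. m + 2) ` odds n)"
    proof (cases "m = 1")
      case False
      then have "m \<ge> 2" using m by (cases m) (auto simp: odds_def)
      then show ?thesis using m by (auto simp: odds_def intro!: image_eqI[of _ _ "m - 2"])
    qed simp
  qed (auto simp: odds_def)
  moreover have "1 \<notin> (\<lambda>m. m + 2) ` odds n" by auto
  ultimately have "(\<Sum>m\<in>odds (n + 2). ratio_coeff (n + 2 - m)) =
      ratio_coeff (n + 1) + (\<Sum>m\<in>odds n. ratio_coeff (n - m))"
    by (simp add: sum.reindex inj_on_def)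
  then show ?case
    using step by (simp add: ratio_coeff_def algebra_simps)
qed

text \<open>
  The multiplicativity of $f \mapsto \sum_i (D_i f) x^i$ on the products with $q_s$: the first factor
  on the right is the image of $q_s$.
\<close>

lemma skew_q_mult:
  "Abs_fps (\<lambda>i. skew i (q_t s * f)) =
   Abs_fps (\<lambda>i. of_int (ratio_coeff i) * q_t (s - int i)) * Abs_fps (\<lambda>i. skew i f)"
proof (rule skew_flow_unique)
  have "skew_flow (Abs_fps (\<lambda>i. of_int (ratio_coeff i) * q_t (s - int i)))"
    unfolding skew_flow_def fps_nth_Abs_fps
  proof
    fix n
    have coeff: "int n * ratio_coeff n = - 2 * (\<Sum>m\<in>odds n. ratio_coeff (n - m))"
      unfolding sum_ratio_coeff by (simp add: ratio_coeff_def)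
    have "of_nat n * (of_int (ratio_coeff n) * q_t (s - int n)) =
        of_int (int n * ratio_coeff n) * q_t (s - int n)"
      by (simp add: mult.assoc)
    also have "\<dots> = of_int (- 2 * (\<Sum>m\<in>odds n. ratio_coeff (n - m))) * q_t (s - int n)"
      by (simp only: coeff)
    also have "\<dots> = - (\<Sum>m\<in>odds n. of_int (ratio_coeff (n - m)) * (2 * q_t (s - int n)))"
      by (simp add: sum_distrib_left sum_distrib_right sum_negf mult_ac)
    also have "(\<Sum>m\<in>odds n. of_int (ratio_coeff (n - m)) * (2 * q_t (s - int n))) =
        (\<Sum>m\<in>odds n. of_nat m * partial m (of_int (ratio_coeff (n - m)) * q_t (s - int (n - m))))"
    proof (rule sum.cong[OF refl])
      fix m assume m: "m \<in> odds n"
      then have "2 * q_t (s - int n) = of_nat m * partial m (q_t (s - int (n - m)))"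
        using partial_q_t[of m "s - int (n - m)"] by (simp add: odds_def of_nat_diff)
      then show "of_int (ratio_coeff (n - m)) * (2 * q_t (s - int n)) =
          of_nat m * partial m (of_int (ratio_coeff (n - m)) * q_t (s - int (n - m)))"
        by (simp add: partial_of_int_mult mult.left_commute)
    qed
    finally show "of_nat n * (of_int (ratio_coeff n) * q_t (s - int n)) =
        - (\<Sum>m\<in>odds n. of_nat m * partial m (of_int (ratio_coeff (n - m)) * q_t (s - int (n - m))))" .
  qed
  then show "skew_flow (Abs_fps (\<lambda>i. of_int (ratio_coeff i) * q_t (s - int i)) * Abs_fps (\<lambda>i. skew i f))"
    by (rule skew_flow_mult[OF _ skew_flow_skew])
qed (simp_all add: skew_flow_skew skew_0 ratio_coeff_def)

lemma skew_q:
  "skew (Suc i) (q_t s * f) + skew i (q_t (s - 1) * f) = q_t s * skew (Suc i) f - q_t (s - 1) * skew i f"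
proof -
  define U where "U s = Abs_fps (\<lambda>i. of_int (ratio_coeff i) * q_t (s - int i))" for s
  define V where "V = Abs_fps (\<lambda>i. skew i f)"
  \<comment> \<open>$(1 + u) \cdot (1 - u)/(1 + u) = 1 - u$\<close>
  have U_rec: "U s + fps_X * U (s - 1) = fps_const (q_t s) - fps_X * fps_const (q_t (s - 1))"
  proof (rule fps_ext)
    fix n
    show "(U s + fps_X * U (s - 1)) $ n = (fps_const (q_t s) - fps_X * fps_const (q_t (s - 1))) $ n"
    proof (cases n)
      case (Suc k)
      then show ?thesis by (cases k) (simp_all add: U_def ratio_coeff_def algebra_simps)
    qed (simp add: U_def ratio_coeff_def)
  qed
  have "skew (Suc i) (q_t s * f) + skew i (q_t (s - 1) * f) =
      ((U s + fps_X * U (s - 1)) * V) $ Suc i"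
    using skew_q_mult[of s f] skew_q_mult[of "s - 1" f]
    by (simp add: U_def V_def distrib_right mult.assoc fps_eq_iff)
  also have "\<dots> = q_t s * skew (Suc i) f - q_t (s - 1) * skew i f"
    unfolding U_rec by (simp add: V_def left_diff_distrib mult.assoc)
  finally show ?thesis .
qed

interpretation gamma: vertex_system q_t skew
  by unfold_locales (simp_all add: skew_add skew_commute skew_0 skew_one skew_finite skew_q q_t_neg q_t_0)

text \<open>
  The modes differ only in how the finite sums are cut off: \<open>q_t\<close> vanishes on the excluded
  indices.
\<close>

lemma Phi_mode_phi: "Phi_mode (- r) f = gamma.phi r f"
proof -
  have "Phi_mode (- r) f = (\<Sum>i | - r \<le> int i \<and> skew i f \<noteq> 0. q_t (int (nat (int i + r))) * skew i f)"
    unfolding Phi_mode_def normal_product_def creation_exp_def[symmetric]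
      annihilation_exp_def[symmetric] app_creation_exp skew_def[symmetric] by simp
  also have "\<dots> = (\<Sum>i | - r \<le> int i \<and> skew i f \<noteq> 0. q_t (r + int i) * skew i f)"
    by (rule sum.cong) (auto simp: add.commute)
  also have "\<dots> = gamma.phi r f"
    unfolding gamma.phi_def
    by (rule sum.mono_neutral_left) (use skew_finite in \<open>auto dest: q_t_nonneg\<close>)
  finally show ?thesis .
qed

lemma foldr_Phi_mode: "foldr (\<lambda>r. Phi_mode (- int r)) l 1 = gamma.word (map int l)"
  by (induction l) (simp_all add: Phi_mode_phi)

text \<open>
  For equal indices \<open>Q2\<close> is 0 by definition, while the word of \<open>[0, 0]\<close> is 1, so they
  have to be distinct.
\<close>

lemma extend_scalars_Q2:
  assumes "r \<noteq> s"
  shows "extend_scalars (Q2 r s) = gamma.word [int r, int s]"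
proof -
  have e2: "extend_scalars 2 = 2" using extend_scalars_of_nat[of 2] by simp
  have em: "extend_scalars ((- 1) ^ k) = (- 1) ^ k" for k
    using extend_scalars_of_int[of "(- 1) ^ k"] by simp
  have "extend_scalars (Q2 r s) = q_t (int r) * q_t (int s) +
      2 * (\<Sum>k=1..s. (- 1) ^ k * q_t (int (r + k)) * q_t (int (s - k)))"
    using assms by (simp add: Q2_def extend_scalars_add extend_scalars_mult extend_scalars_sum e2 em
        q_t_int del: of_nat_add of_nat_diff)
  also have "(\<Sum>k=1..s. (- 1) ^ k * q_t (int (r + k)) * q_t (int (s - k))) =
      (\<Sum>k=1..s. (- 1) ^ k * q_t (int r + int k) * q_t (int s - int k))"
    by (rule sum.cong) (auto simp: of_nat_diff)
  also have "\<dots> = (\<Sum>k=1..Suc s. (- 1) ^ k * q_t (int r + int k) * q_t (int s - int k))"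
    by (simp add: q_t_neg)
  also have "\<dots> = (\<Sum>k\<le>s. (- 1) ^ Suc k * q_t (int r + int (Suc k)) * q_t (int s - int (Suc k)))"
    by (rule sum.reindex_bij_witness[of _ Suc "\<lambda>k. k - 1"]) auto
  also have "q_t (int r) * q_t (int s) + 2 * \<dots> = gamma.word [int r, int s]"
    by (rule gamma.word_two[symmetric]) simp
  finally show ?thesis .
qed

lemma extend_scalars_schur_Q:
  assumes "strict_partition l"
  shows "extend_scalars (schur_Q l) = gamma.word (map int l)"
proof -
  let ?l = "even_padding l" and ?n = "length (even_padding l) div 2"
  have len: "length ?l = 2 * ?n"
    by (simp add: even_padding_def)
  \<comment> \<open>The padding zero keeps the list strictly decreasing, as the parts are positive.\<close>
  have decr: "sorted_wrt (>) ?l"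
    using assms by (auto simp: strict_partition_def even_padding_def sorted_wrt_append)
  have "extend_scalars (schur_Q l) =
      Pf ?n (\<lambda>i j. gamma.word [map int ?l ! i, map int ?l ! j])"
    unfolding schur_Q_def extend_scalars_Pf
  proof (rule Pf_cong)
    fix i j assume ij: "i < j" "j < 2 * ?n"
    then have "?l ! j < ?l ! i"
      using decr len by (auto simp: sorted_wrt_iff_nth_less)
    then show "extend_scalars (Q_matrix ?l i j) = gamma.word [map int ?l ! i, map int ?l ! j]"
      using ij len by (simp add: Q_matrix_def extend_scalars_Q2 del: foldr.simps)
  qed
  also have "\<dots> = gamma.word (map int ?l)"
  proof (rule Pf_unique[where M = "\<lambda>x y. gamma.word [x, y]"])
    show "gamma.word (x # xs) = (\<Sum>k<length xs. (- 1) ^ k *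
        (gamma.word [x, xs ! k] * gamma.word (take k xs @ drop (Suc k) xs)))" if "odd (length xs)" for x xs
      using gamma.word_expand[OF that, of x] unfolding remove_sum_conv_sum .
    show "length (map int ?l) = 2 * ?n" using len by simp
  qed simp
  also have "\<dots> = gamma.word (map int l)"
    using gamma.word_append_0[of "map int l"] by (simp add: even_padding_def)
  finally show ?thesis .
qed


section \<open>Conjugation by the rescaling automorphism\<close>

definition rho_op :: lin_op where
  "rho_op = Lin_op rho_t"

lemma app_rho_op [simp]: "app rho_op f = rho_t f"
  by (simp add: rho_op_def Lin_op_inverse is_linear_def rho_t_add rho_t_scale)

lemma partial_rho_t:
  assumes "odd n"
  shows "partial n (rho_t f) = const_poly (1 - t_var ^ n) * rho_t (partial n f)"
proof (rule poly_mapping_eqI)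
  fix m
  have "rho_weight (Poly_Mapping.single (n div 2) 1) = 1 - t_var ^ n"
    using assms by (simp add: rho_weight_def)
  then show "Poly_Mapping.lookup (partial n (rho_t f)) m =
      Poly_Mapping.lookup (const_poly (1 - t_var ^ n) * rho_t (partial n f)) m"
    by (simp add: lookup_partial lookup_rho_t lookup_const_poly_mult rho_weight_add
        del: of_nat_Suc)
qed

lemma rho_t_creation:
  "rho_t (app (alg_exp scalar_op (odd_series (\<lambda>n. scalar_op (2 / of_nat n) * creation n)) $ i) f) =
   app (alg_exp scalar_op (odd_series (\<lambda>n. scalar_op (2 * (1 - t_var ^ n) / of_nat n) * creation n)) $ i)
     (rho_t f)"
proof -
  have "rho_op * (scalar_op (2 / of_nat n) * creation n) =
      scalar_op (2 * (1 - t_var ^ n) / of_nat n) * creation n * rho_op" if "odd n" for n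
  proof (rule lin_op_eqI)
    fix f
    have "2 * (1 - t_var ^ n) / of_nat n = 2 / of_nat n * (1 - t_var ^ n)" by simp
    then show "app (rho_op * (scalar_op (2 / of_nat n) * creation n)) f =
        app (scalar_op (2 * (1 - t_var ^ n) / of_nat n) * creation n * rho_op) f"
      by (simp only: app_times app_scalar_op app_creation app_rho_op rho_t_scale)
        (simp only: const_poly_mult rho_t_mult rho_t_psum[OF that] mult_ac)
  qed
  then have "rho_op * alg_exp scalar_op (odd_series (\<lambda>n. scalar_op (2 / of_nat n) * creation n)) $ i =
      alg_exp scalar_op (odd_series (\<lambda>n. scalar_op (2 * (1 - t_var ^ n) / of_nat n) * creation n)) $ i * rho_op"
    by (intro alg_exp_intertwine) (auto simp: odd_series_def scalar_op_central)
  from arg_cong[OF this, of "\<lambda>A. app A f"] show ?thesis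
    by (simp only: app_times app_rho_op)
qed

lemma rho_t_annihilation:
  "rho_t (app (alg_exp scalar_op (- odd_series (\<lambda>n. scalar_op (2 / of_nat n) * annihilation n)) $ i) f) =
   app (alg_exp scalar_op
     (- odd_series (\<lambda>n. scalar_op (2 / (of_nat n * (1 - t_var ^ n))) * annihilation n)) $ i) (rho_t f)"
proof -
  have "rho_op * (scalar_op (2 / of_nat n) * annihilation n) =
      scalar_op (2 / (of_nat n * (1 - t_var ^ n))) * annihilation n * rho_op" if "odd n" for n
  proof (rule lin_op_eqI)
    fix f
    have t: "1 - t_var ^ n \<noteq> 0" by (rule one_minus_t_power_nonzero[OF odd_pos[OF that]])
    have cancel: "2 / (a * u) * (a / 2) * u = 2 / a * (a / 2)" if "u \<noteq> 0" for a u :: ratfun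
      using that by (cases "a = 0") simp_all
    have "app (scalar_op (2 / (of_nat n * (1 - t_var ^ n))) * annihilation n * rho_op) f =
        const_poly (2 / (of_nat n * (1 - t_var ^ n)) * (of_nat n / 2) * (1 - t_var ^ n)) * rho_t (partial n f)"
      by (simp only: app_times app_scalar_op app_annihilation app_rho_op partial_rho_t[OF that]
          const_poly_mult mult.assoc)
    also have "2 / (of_nat n * (1 - t_var ^ n)) * (of_nat n / 2) * (1 - t_var ^ n) =
        2 / of_nat n * (of_nat n / 2 :: ratfun)"
      by (rule cancel[OF t])
    finally show "app (rho_op * (scalar_op (2 / of_nat n) * annihilation n)) f =
        app (scalar_op (2 / (of_nat n * (1 - t_var ^ n))) * annihilation n * rho_op) f"
      by (simp only: app_times app_scalar_op app_annihilation app_rho_op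
          rho_t_scale const_poly_mult mult.assoc)
  qed
  then have "rho_op * alg_exp scalar_op (- odd_series (\<lambda>n. scalar_op (2 / of_nat n) * annihilation n)) $ i =
      alg_exp scalar_op (- odd_series (\<lambda>n. scalar_op (2 / (of_nat n * (1 - t_var ^ n))) * annihilation n)) $ i * rho_op"
    by (intro alg_exp_intertwine) (auto simp: odd_series_def scalar_op_central)
  from arg_cong[OF this, of "\<lambda>A. app A f"] show ?thesis
    by (simp only: app_times app_rho_op)
qed

lemma Y_mode_rho_t: "Y_mode m (rho_t f) = rho_t (Phi_mode m f)"
proof -
  have "rho_t 0 = 0" using rho_t_sum[of _ "{}"] by simp
  then have "rho_t f = 0 \<longleftrightarrow> f = 0" for f
    using bij_rho_t by (metis bij_is_inj injD)
  then show ?thesis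
    unfolding Y_mode_def Phi_mode_def normal_product_def rho_t_sum rho_t_creation rho_t_annihilation
    by (simp flip: rho_t_annihilation)
qed

lemma QY_eq: "QY l = rho_t (foldr (\<lambda>r. Phi_mode (- int r)) l 1)"
  by (induction l) (simp_all add: QY_def rho_t_one Y_mode_rho_t)

theorem proposition2p1:
  shows "(\<forall>m. Y_mode m = rho_t \<circ> Phi_mode m \<circ> inv rho_t) \<and>
    (\<forall>l. strict_partition l \<longrightarrow>
       QY l = rho_t (extend_scalars (schur_Q l)) \<and>
       rho_t (extend_scalars (schur_Q l)) = pleth_X_minus_tX (schur_Q l))"
proof (intro conjI allI impI)
  show "Y_mode m = rho_t \<circ> Phi_mode m \<circ> inv rho_t" for m
    using bij_rho_t by (simp add: fun_eq_iff Y_mode_rho_t[symmetric] bij_is_surj surj_f_inv_f)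
  show "QY l = rho_t (extend_scalars (schur_Q l))" if "strict_partition l" for l
    using that by (simp add: QY_eq foldr_Phi_mode extend_scalars_schur_Q)
  show "rho_t (extend_scalars (schur_Q l)) = pleth_X_minus_tX (schur_Q l)" for l
    by (rule rho_t_extend_scalars)
qed

end
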